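(* Let $\theta\in\mathbb R\setminus\mathbb Q$. The following statements are equivalent: (i) $\theta$ is badly approximable, i.e. $\theta\in\mathfrak B$. (ii) ${}^*\mathbb Z^\mu_\nu(\theta)=0$ for all $\mu,\nu\in\mathbb P_\varepsilon$ with $\mu\ge\nu$. (iii) $\mathbb P_\varepsilon^{\rm bg}(\theta)=\mathbb P_\varepsilon$. In particular, for all $\widehat\mu\in\mathbb P_\varepsilon^{\rm bg}(\theta)$, $\widehat\mu^+=\widehat\mu$. (iv) $\widehat\mu=\widehat\nu$ for every best growth-decay pair $(\widehat\mu,\widehat\nu)$ of $\theta$: that is, $\mathbb P_\varepsilon^{\rm bg}(\theta)=\mathbb P_\varepsilon^{\rm bd}(\theta)$.
   Context: Fix a nonprincipal ultrafilter $\mathfrak u$ on $\mathbb N$, and let ${}^*\mathbb Z\subset{}^*\mathbb R$ be the ultrapowers of $\mathbb Z\subset\mathbb R$. Let ${}^*\mathbb R_{\rm fin}$ be the ring of bounded elements, ${}^*\mathbb R_\varepsilon$ its ideal of infinitesimals, and $({}^*\mathbb R_{\rm fin})^\times_+$ the multiplicative group of positive elements that are neither infinite nor infinitesimal. Let $\mathbb P:=({}^*\mathbb R_{>0}\cup\{0\})/({}^*\mathbb R_{\rm fin})^\times_+$; write $\langle x\rangle\in\mathbb P$ for the class of $|x|$, and $-\infty:=\langle0\rangle$. $\mathbb P$ has the induced product and total order (for $\mu\neq\mu'$, $\mu<\mu'$ iff $x<x'$ for any representatives $x$ of $\mu$, $x'$ of $\mu'$; $-\infty$ is the minimum). $\mathbb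 P_\varepsilon\subset\mathbb P$ is the set of classes of positive infinitesimals. For $0\ne n\in{}^*\mathbb Z$ the growth is $\mu(n):=\langle n^{-1}\rangle$. For $\theta\in\mathbb R$, ${}^*\mathbb Z(\theta)$ is the group of $n\in{}^*\mathbb Z$ for which there is a (unique) $n^\perp\in{}^*\mathbb Z$ with $\varepsilon(n):=n\theta-n^\perp\in{}^*\mathbb R_\varepsilon$; the decay of $n\in{}^*\mathbb Z(\theta)$ is $\nu(n):=\langle\varepsilon(n)\rangle$. For $\mu,\nu\in\mathbb P_\varepsilon$, ${}^*\mathbb Z^\mu_\nu(\theta):=\{0\neq n\in{}^*\mathbb Z(\theta):\mu(n)>\mu,\ \nu(n)\le\nu\}\cup\{0\}$, a subgroup of ${}^*\mathbb Z(\theta)$. $\mathfrak B$ is the set of badly approximable numbers: irrational $\theta$ with $\liminf_{n\to\infty}n\|n\theta\|>0$, $\|\cdot\|$ the distance to the nearest integer. Let $\theta\in\mathbb R\setminus\mathbb Q$ have continued fraction expansion $[a_0a_1a_2\dots]$ with best (convergent) denominators $q_0=1$, $q_1=a_1$, $q_{i+1}=a_{i+1}q_i+q_{i-1}$. A best denominator class is the class $\widehat q\in{}^*\mathbb Z$ of a sequence $\{q_{n_i}\}_i$ of best denominators of $\theta$ in which $n_i\le n_{i+1}$ for all $i$ and $n_i\to\infty$; it lies in ${}^*\mathbb Z(\theta)$. Its best growth and best decay are $\widehat\mu:=\mu(\widehat q)$ and $\widehat\nu:=\nu(\widehat q)$, and $(\widehat\mu,\widehat\nu)$ is called a best growth-decay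 pair. The successor $\widehat q^+$ of $\widehat q$ is the class of $\{q_{n_i+1}\}_i$, and $\widehat\mu^+:=\mu(\widehat q^+)$. $\mathbb P_\varepsilon^{\rm bg}(\theta)$ (resp. $\mathbb P_\varepsilon^{\rm bd}(\theta)$) is the set of all best growths (resp. best decays) of best denominator classes of $\theta$.
   Formalization: The conditions n_i ≤ n_{i+1} and n_i → ∞ on best denominator classes are imposed modulo the ultrafilter (literally, (i)⇒(iii) fails for some ultrafilters); P^bg = P^bd is only stated as a consequence of (iv), since it holds for every irrational θ. *)

theory Defs
  imports Complex_Main "HOL-Library.Extended_Real"
begin

definition nonprincipal_ultrafilter :: "nat filter \<Rightarrow> bool" where
  "nonprincipal_ultrafilter U \<longleftrightarrow>
     U \<noteq> bot \<and>
     (\<forall>P. eventually P U \<or> eventually (\<lambda>i. \<not> P i) U) \<and>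
     (\<forall>k. eventually (\<lambda>i. i \<noteq> k) U)"

text \<open>The ultrapower depends on the arbitrary ultrafilter \<open>U\<close>, so it cannot be a type of its
  own. A hyperreal is an equivalence class of real sequences modulo \<open>U\<close>, and the hyperintegers
  are the classes of integer-valued sequences among them.\<close>

type_synonym hyperreal = "(nat \<Rightarrow> real) set"

definition star_rel :: "nat filter \<Rightarrow> ((nat \<Rightarrow> real) \<times> (nat \<Rightarrow> real)) set" where
  "star_rel U = {(x, y). eventually (\<lambda>i. x i = y i) U}"

definition star_class :: "nat filter \<Rightarrow> (nat \<Rightarrow> real) \<Rightarrow> hyperreal" where
  "star_class U x = star_rel U `` {x}"

definition ultrapower :: "nat filter \<Rightarrow> real set \<Rightarrow> hyperreal set" where
  "ultrapower U A = {star_class U x | x. \<forall>i. x i \<in> A}"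

abbreviation star_real :: "nat filter \<Rightarrow> hyperreal set" where
  "star_real U \<equiv> ultrapower U UNIV"

abbreviation star_int :: "nat filter \<Rightarrow> hyperreal set" where
  "star_int U \<equiv> ultrapower U \<int>"

definition star_of :: "nat filter \<Rightarrow> real \<Rightarrow> hyperreal" where
  "star_of U r = star_class U (\<lambda>_. r)"

definition star_map :: "nat filter \<Rightarrow> (real \<Rightarrow> real) \<Rightarrow> hyperreal \<Rightarrow> hyperreal" where
  "star_map U f X = {z. \<exists>x\<in>X. eventually (\<lambda>i. z i = f (x i)) U}"

definition star_map2 ::
  "nat filter \<Rightarrow> (real \<Rightarrow> real \<Rightarrow> real) \<Rightarrow> hyperreal \<Rightarrow> hyperreal \<Rightarrow> hyperreal" where
  "star_map2 U f X Y = {z. \<exists>x\<in>X. \<exists>y\<in>Y. eventually (\<lambda>i. z i = f (x i) (y i)) U}"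

abbreviation star_abs :: "nat filter \<Rightarrow> hyperreal \<Rightarrow> hyperreal" where
  "star_abs U \<equiv> star_map U abs"

abbreviation star_inverse :: "nat filter \<Rightarrow> hyperreal \<Rightarrow> hyperreal" where
  "star_inverse U \<equiv> star_map U inverse"

abbreviation star_mult :: "nat filter \<Rightarrow> hyperreal \<Rightarrow> hyperreal \<Rightarrow> hyperreal" where
  "star_mult U \<equiv> star_map2 U (*)"

abbreviation star_minus :: "nat filter \<Rightarrow> hyperreal \<Rightarrow> hyperreal \<Rightarrow> hyperreal" where
  "star_minus U \<equiv> star_map2 U (-)"

definition star_less :: "nat filter \<Rightarrow> hyperreal \<Rightarrow> hyperreal \<Rightarrow> bool" where
  "star_less U X Y \<longleftrightarrow> (\<exists>x\<in>X. \<exists>y\<in>Y. eventually (\<lambda>i. x i < y i) U)"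

definition star_fin :: "nat filter \<Rightarrow> hyperreal set" where
  "star_fin U = {X \<in> star_real U. \<exists>r. star_less U (star_abs U X) (star_of U r)}"

definition star_infinitesimal :: "nat filter \<Rightarrow> hyperreal set" where
  "star_infinitesimal U = {X \<in> star_real U. \<forall>r>0. star_less U (star_abs U X) (star_of U r)}"

definition fin_units_pos :: "nat filter \<Rightarrow> hyperreal set" where
  "fin_units_pos U =
     {X \<in> star_fin U. star_less U (star_of U 0) X \<and> X \<notin> star_infinitesimal U}"

definition star_nonneg :: "nat filter \<Rightarrow> hyperreal set" where
  "star_nonneg U = {X \<in> star_real U. star_less U (star_of U 0) X} \<union> {star_of U 0}"

definition orbit_rel :: "nat filter \<Rightarrow> (hyperreal \<times> hyperreal) set" where
  "orbit_rel U = {(X, Y). X \<in> star_nonneg U \<and> Y \<in> star_nonneg U \<and>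
     (\<exists>u\<in>fin_units_pos U. Y = star_mult U u X)}"

definition PP :: "nat filter \<Rightarrow> hyperreal set set" where
  "PP U = star_nonneg U // orbit_rel U"

definition PP_class :: "nat filter \<Rightarrow> hyperreal \<Rightarrow> hyperreal set" where
  "PP_class U X = orbit_rel U `` {star_abs U X}"

definition PP_less :: "nat filter \<Rightarrow> hyperreal set \<Rightarrow> hyperreal set \<Rightarrow> bool" where
  "PP_less U \<mu> \<mu>' \<longleftrightarrow> \<mu> \<noteq> \<mu>' \<and> (\<forall>X\<in>\<mu>. \<forall>X'\<in>\<mu>'. star_less U X X')"

definition PP_le :: "nat filter \<Rightarrow> hyperreal set \<Rightarrow> hyperreal set \<Rightarrow> bool" where
  "PP_le U \<mu> \<mu>' \<longleftrightarrow> \<mu> = \<mu>' \<or> PP_less U \<mu> \<mu>'"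

definition PP_eps :: "nat filter \<Rightarrow> hyperreal set set" where
  "PP_eps U = {\<mu> \<in> PP U. \<exists>X\<in>star_infinitesimal U.
     star_less U (star_of U 0) X \<and> \<mu> = PP_class U X}"

definition growth :: "nat filter \<Rightarrow> hyperreal \<Rightarrow> hyperreal set" where
  "growth U N = PP_class U (star_inverse U N)"

definition star_int_approx :: "nat filter \<Rightarrow> real \<Rightarrow> hyperreal set" where
  "star_int_approx U \<theta> = {N \<in> star_int U. \<exists>M\<in>star_int U.
     star_minus U (star_mult U N (star_of U \<theta>)) M \<in> star_infinitesimal U}"

definition perp :: "nat filter \<Rightarrow> real \<Rightarrow> hyperreal \<Rightarrow> hyperreal" where
  "perp U \<theta> N = (THE M. M \<in> star_int U \<and>
     star_minus U (star_mult U N (star_of U \<theta>)) M \<in> star_infinitesimal U)"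

definition error_term :: "nat filter \<Rightarrow> real \<Rightarrow> hyperreal \<Rightarrow> hyperreal" where
  "error_term U \<theta> N = star_minus U (star_mult U N (star_of U \<theta>)) (perp U \<theta> N)"

definition decay :: "nat filter \<Rightarrow> real \<Rightarrow> hyperreal \<Rightarrow> hyperreal set" where
  "decay U \<theta> N = PP_class U (error_term U \<theta> N)"

definition growth_decay_group ::
  "nat filter \<Rightarrow> real \<Rightarrow> hyperreal set \<Rightarrow> hyperreal set \<Rightarrow> hyperreal set" where
  "growth_decay_group U \<theta> \<mu> \<nu> =
     {N \<in> star_int_approx U \<theta>. N \<noteq> star_of U 0 \<and>
        PP_less U \<mu> (growth U N) \<and> PP_le U (decay U \<theta> N) \<nu>} \<union> {star_of U 0}"

definition dist_nearest_int :: "real \<Rightarrow> real" where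
  "dist_nearest_int x = \<bar>x - of_int (round x)\<bar>"

definition badly_approximable :: "real set" where
  "badly_approximable = {\<theta>. \<theta> \<notin> \<rat> \<and>
     liminf (\<lambda>n. ereal (real n * dist_nearest_int (real n * \<theta>))) > 0}"

fun complete_quotient :: "real \<Rightarrow> nat \<Rightarrow> real" where
  "complete_quotient \<theta> 0 = \<theta>"
| "complete_quotient \<theta> (Suc n) = 1 / frac (complete_quotient \<theta> n)"

definition partial_quotient :: "real \<Rightarrow> nat \<Rightarrow> int" where
  "partial_quotient \<theta> n = \<lfloor>complete_quotient \<theta> n\<rfloor>"

fun best_denom :: "real \<Rightarrow> nat \<Rightarrow> int" where
  "best_denom \<theta> 0 = 1"
| "best_denom \<theta> (Suc 0) = partial_quotient \<theta> 1"
| "best_denom \<theta> (Suc (Suc n)) =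
     partial_quotient \<theta> (Suc (Suc n)) * best_denom \<theta> (Suc n) + best_denom \<theta> n"

text \<open>A best denominator class is an element of the ultrapower, so the two conditions on the index
  sequence, \<open>n i \<le> n (i + 1)\<close> and \<open>n i \<rightarrow> \<infinity>\<close>, are imposed modulo \<open>U\<close>. Imposing them at every
  \<open>i\<close> would make the set of best growths depend on \<open>U\<close>: unless \<open>U\<close> is selective, there are
  infinitesimals whose class in \<open>PP U\<close> is not represented by any sequence that is monotone at
  every \<open>i\<close>, and then not every element of \<open>PP_eps U\<close> is a best growth, even for a badly
  approximable number. For selective \<open>U\<close> both conditions define the same classes; modulo \<open>U\<close>,
  the first one can always be met by changing the sequence on a set outside \<open>U\<close>.\<close>

definition best_index :: "nat filter \<Rightarrow> (nat \<Rightarrow> nat) \<Rightarrow> bool" where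
  "best_index U n \<longleftrightarrow> eventually (\<lambda>i. n i \<le> n (Suc i)) U \<and> filterlim n at_top U"

definition best_denom_class :: "nat filter \<Rightarrow> real \<Rightarrow> (nat \<Rightarrow> nat) \<Rightarrow> hyperreal" where
  "best_denom_class U \<theta> n = star_class U (\<lambda>i. of_int (best_denom \<theta> (n i)))"

text \<open>The successor of the class given by the index sequence \<open>n\<close>.\<close>

definition best_denom_succ :: "nat filter \<Rightarrow> real \<Rightarrow> (nat \<Rightarrow> nat) \<Rightarrow> hyperreal" where
  "best_denom_succ U \<theta> n = best_denom_class U \<theta> (\<lambda>i. n i + 1)"

definition best_growths :: "nat filter \<Rightarrow> real \<Rightarrow> hyperreal set set" where
  "best_growths U \<theta> = {growth U (best_denom_class U \<theta> n) | n. best_index U n}"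

definition best_decays :: "nat filter \<Rightarrow> real \<Rightarrow> hyperreal set set" where
  "best_decays U \<theta> = {decay U \<theta> (best_denom_class U \<theta> n) | n. best_index U n}"

definition best_growth_decay_pairs ::
  "nat filter \<Rightarrow> real \<Rightarrow> (hyperreal set \<times> hyperreal set) set" where
  "best_growth_decay_pairs U \<theta> =
     {(growth U (best_denom_class U \<theta> n), decay U \<theta> (best_denom_class U \<theta> n)) | n.
        best_index U n}"

lemma star_class_eq_iff: "star_class U x = star_class U y \<longleftrightarrow> eventually (\<lambda>i. x i = y i) U"
proof
  assume "star_class U x = star_class U y"
  moreover have "y \<in> star_class U y" by (simp add: star_class_def star_rel_def)
  ultimately have "y \<in> star_class U x" by simp
  then show "eventually (\<lambda>i. x i = y i) U" by (simp add: star_class_def star_rel_def)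
next
  assume xy: "eventually (\<lambda>i. x i = y i) U"
  have "eventually (\<lambda>i. x i = z i) U \<longleftrightarrow> eventually (\<lambda>i. y i = z i) U" for z
    using xy by (rule eventually_cong) simp
  then show "star_class U x = star_class U y" by (simp add: star_class_def star_rel_def)
qed

lemma star_map_class: "star_map U f (star_class U x) = star_class U (\<lambda>i. f (x i))"
proof (intro set_eqI iffI)
  fix z assume "z \<in> star_map U f (star_class U x)"
  then obtain y where "eventually (\<lambda>i. x i = y i) U" "eventually (\<lambda>i. z i = f (y i)) U"
    by (auto simp: star_map_def star_class_def star_rel_def)
  then have "eventually (\<lambda>i. f (x i) = z i) U" by eventually_elim simp
  then show "z \<in> star_class U (\<lambda>i. f (x i))" by (simp add: star_class_def star_rel_def)
next
  fix z assume "z \<in> star_class U (\<lambda>i. f (x i))"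
  then have "eventually (\<lambda>i. z i = f (x i)) U"
    by (simp add: star_class_def star_rel_def eq_commute)
  then show "z \<in> star_map U f (star_class U x)"
    by (auto simp: star_map_def star_class_def star_rel_def intro!: exI[of _ x])
qed

lemma star_map2_class:
  "star_map2 U f (star_class U x) (star_class U y) = star_class U (\<lambda>i. f (x i) (y i))"
proof (intro set_eqI iffI)
  fix z assume "z \<in> star_map2 U f (star_class U x) (star_class U y)"
  then obtain x' y' where "eventually (\<lambda>i. x i = x' i) U" "eventually (\<lambda>i. y i = y' i) U"
      "eventually (\<lambda>i. z i = f (x' i) (y' i)) U"
    by (auto simp: star_map2_def star_class_def star_rel_def)
  then have "eventually (\<lambda>i. f (x i) (y i) = z i) U" by eventually_elim simp
  then show "z \<in> star_class U (\<lambda>i. f (x i) (y i))" by (simp add: star_class_def star_rel_def)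
next
  fix z assume "z \<in> star_class U (\<lambda>i. f (x i) (y i))"
  then have z: "eventually (\<lambda>i. z i = f (x i) (y i)) U"
    by (simp add: star_class_def star_rel_def eq_commute)
  have "x \<in> star_class U x" "y \<in> star_class U y"
    by (simp_all add: star_class_def star_rel_def)
  with z show "z \<in> star_map2 U f (star_class U x) (star_class U y)"
    unfolding star_map2_def by blast
qed

lemma star_less_class:
  "star_less U (star_class U x) (star_class U y) \<longleftrightarrow> eventually (\<lambda>i. x i < y i) U"
proof
  assume "star_less U (star_class U x) (star_class U y)"
  then obtain x' y' where "eventually (\<lambda>i. x i = x' i) U" "eventually (\<lambda>i. y i = y' i) U"
      "eventually (\<lambda>i. x' i < y' i) U"
    by (auto simp: star_less_def star_class_def star_rel_def)
  then show "eventually (\<lambda>i. x i < y i) U" by eventually_elim simp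
next
  assume "eventually (\<lambda>i. x i < y i) U"
  moreover have "x \<in> star_class U x" "y \<in> star_class U y"
    by (simp_all add: star_class_def star_rel_def)
  ultimately show "star_less U (star_class U x) (star_class U y)"
    unfolding star_less_def by blast
qed

lemma nonprincipal_ultrafilter_le_sequentially:
  assumes "nonprincipal_ultrafilter U"
  shows "U \<le> sequentially"
proof (rule filter_leI)
  fix P :: "nat \<Rightarrow> bool" assume "eventually P sequentially"
  then obtain N where N: "\<And>i. N \<le> i \<Longrightarrow> P i" by (auto simp: eventually_sequentially)
  have "eventually (\<lambda>i. \<forall>k\<in>{..<N}. i \<noteq> k) U"
    using assms by (subst eventually_ball_finite_distrib)
      (auto simp: nonprincipal_ultrafilter_def)
  then show "eventually P U"
  proof (rule eventually_mono)
    fix i assume "\<forall>k\<in>{..<N}. i \<noteq> k"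
    then have "N \<le> i" by (metis lessThan_iff not_less)
    then show "P i" by (rule N)
  qed
qed

lemma best_index_if_mono:
  assumes "nonprincipal_ultrafilter U" "\<And>i. n i \<le> n (Suc i)" "filterlim n at_top sequentially"
  shows "best_index U n"
  using assms nonprincipal_ultrafilter_le_sequentially[OF assms(1)]
  by (auto simp: best_index_def intro: filterlim_mono)

end

theory Submission
  imports Defs
begin

text \<open>Write \<open>q k\<close> for the best denominators and \<open>E k = \<bar>q k * \<theta> - p k\<bar>\<close> for the errors of the
  convergents. Since \<open>E k * q (k + 1) + E (k + 1) * q k = 1\<close>, the error \<open>E k\<close> is comparable to
  \<open>1 / q (k + 1)\<close>: the decay of a best denominator class is the growth of its successor.
  Consequently \<open>\<theta>\<close> is badly approximable iff the ratios \<open>q (k + 1) / q k\<close> are bounded. If they are,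
  \<open>\<bar>n\<bar> * \<bar>n * \<theta> - m\<bar>\<close> is bounded away from 0 for all \<open>n \<noteq> 0\<close>, and every large number is comparable
  to the best denominator just below it. If they are not, a best denominator class whose successor
  is infinitely larger violates each of the conditions (ii), (iii) and (iv).\<close>

section \<open>Continued fractions\<close>

text \<open>This is the absolute error of the \<open>n\<close>-th convergent, see
  \<open>best_denom_error_int\<close>. The product form needs no numerators and makes positivity and
  decrease immediate.\<close>

definition approx_error :: "real \<Rightarrow> nat \<Rightarrow> real" where
  "approx_error \<theta> n = (\<Prod>k\<le>n. frac (complete_quotient \<theta> k))"

lemma frac_pos_if_irrational: "(x::real) \<notin> \<rat> \<Longrightarrow> 0 < frac x"
  by (metis Ints_subset_Rats frac_gt_0_iff subsetD)

lemma frac_irrational: "(x::real) \<notin> \<rat> \<Longrightarrow> frac x \<notin> \<rat>"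
  unfolding frac_def by (metis Rats_add Rats_of_int diff_add_cancel)

lemma complete_quotient_irrational: "\<theta> \<notin> \<rat> \<Longrightarrow> complete_quotient \<theta> n \<notin> \<rat>"
proof (induction n)
  case (Suc n)
  then have "frac (complete_quotient \<theta> n) \<notin> \<rat>" by (simp add: frac_irrational)
  then show ?case
    by (metis Rats_inverse complete_quotient.simps(2) inverse_eq_divide inverse_inverse_eq)
qed simp

lemma approx_error_Suc:
  "approx_error \<theta> (Suc n) = approx_error \<theta> n * frac (complete_quotient \<theta> (Suc n))"
  by (simp add: approx_error_def)

lemma best_denom_rec:
  "real_of_int (best_denom \<theta> (Suc (Suc n))) =
     of_int (partial_quotient \<theta> (Suc (Suc n))) * of_int (best_denom \<theta> (Suc n)) + of_int (best_denom \<theta> n)"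
  by simp

context
  fixes \<theta> :: real
  assumes irrational: "\<theta> \<notin> \<rat>"
begin

lemma frac_complete_quotient_pos: "0 < frac (complete_quotient \<theta> n)"
  by (intro frac_pos_if_irrational complete_quotient_irrational irrational)

lemma approx_error_pos: "0 < approx_error \<theta> n"
  unfolding approx_error_def by (intro prod_pos frac_complete_quotient_pos)

lemma approx_error_Suc_less: "approx_error \<theta> (Suc n) < approx_error \<theta> n"
  using approx_error_pos[of n] frac_lt_1[of "complete_quotient \<theta> (Suc n)"]
  by (simp add: approx_error_Suc)

text \<open>The last factor of the product is the reciprocal of the next complete quotient, so the
  two cancel.\<close>

lemma approx_error_Suc_mult:
  "approx_error \<theta> (Suc n) * complete_quotient \<theta> (Suc (Suc n)) = approx_error \<theta> n"
  using frac_complete_quotient_pos[of "Suc n"]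
  unfolding approx_error_Suc complete_quotient.simps(2)[of \<theta> "Suc n"] by simp

text \<open>Splitting the complete quotient in \<open>approx_error_Suc_mult\<close> into integer and
  fractional part gives the recursion of the denominators, with a minus sign because the alternating
  signs of the errors are stripped off.\<close>

lemma approx_error_rec:
  "approx_error \<theta> (Suc (Suc n)) =
     approx_error \<theta> n - of_int (partial_quotient \<theta> (Suc (Suc n))) * approx_error \<theta> (Suc n)"
  using approx_error_Suc_mult[of n] unfolding approx_error_Suc[of \<theta> "Suc n"] frac_def partial_quotient_def
  by (simp only: algebra_simps)

lemma approx_error_0: "approx_error \<theta> 0 = \<theta> - of_int \<lfloor>\<theta>\<rfloor>"
  by (simp add: approx_error_def frac_def)

text \<open>This is the recursion one index earlier, with the value 1 in place of an error at index
  -1.\<close>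

lemma approx_error_1:
  "approx_error \<theta> (Suc 0) = 1 - of_int (partial_quotient \<theta> (Suc 0)) * approx_error \<theta> 0"
proof -
  have "approx_error \<theta> 0 * complete_quotient \<theta> (Suc 0) = 1"
    using frac_complete_quotient_pos[of 0] by (simp add: approx_error_def)
  then show ?thesis
    unfolding approx_error_Suc[of \<theta> 0] frac_def partial_quotient_def by (simp only: algebra_simps)
qed

text \<open>From index 1 on, complete quotients are reciprocals of numbers strictly between 0 and 1.
  The quotient at index 0 can be any integer.\<close>

lemma partial_quotient_ge_1: "1 \<le> partial_quotient \<theta> (Suc n)"
  using frac_complete_quotient_pos[of n] frac_lt_1[of "complete_quotient \<theta> n"]
  by (simp add: partial_quotient_def le_floor_iff)

text \<open>Proved jointly, since monotonicity at the next index uses positivity at the previous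
  ones.\<close>

lemma best_denom_pos_and_mono: "1 \<le> best_denom \<theta> n \<and> best_denom \<theta> n \<le> best_denom \<theta> (Suc n)"
proof (induction n)
  case 0
  show ?case using partial_quotient_ge_1[of 0] by simp
next
  case (Suc n)
  then have "1 * best_denom \<theta> (Suc n) \<le> partial_quotient \<theta> (Suc (Suc n)) * best_denom \<theta> (Suc n)"
    by (intro mult_right_mono partial_quotient_ge_1) auto
  with Suc show ?case unfolding best_denom.simps(3) by linarith
qed

lemma best_denom_ge_1: "1 \<le> best_denom \<theta> n"
  using best_denom_pos_and_mono by blast

lemma best_denom_pos: "0 < best_denom \<theta> n"
  using best_denom_ge_1[of n] by simp

lemma best_denom_mono: "m \<le> n \<Longrightarrow> best_denom \<theta> m \<le> best_denom \<theta> n"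
  by (rule lift_Suc_mono_le) (use best_denom_pos_and_mono in auto)

text \<open>From index 1 on, each step adds at least the preceding denominator, hence at least 1.
  This crude bound is what sends the denominators to infinity.\<close>

lemma best_denom_ge_index: "int n \<le> best_denom \<theta> n"
proof (induction n)
  case (Suc n)
  show ?case
  proof (cases n)
    case 0
    then show ?thesis using best_denom_ge_1[of 1] by simp
  next
    case (Suc m)
    have "1 * best_denom \<theta> n \<le> partial_quotient \<theta> (Suc n) * best_denom \<theta> n"
      by (intro mult_right_mono partial_quotient_ge_1) (use best_denom_pos[of n] in auto)
    with Suc Suc.IH best_denom_ge_1[of m] show ?thesis unfolding Suc best_denom.simps(3) by linarith
  qed
qed simp

text \<open>Denominators, numerators and signed errors obey the same two-term recursion, so the
  induction carries two consecutive indices. Only the existence of the numerators matters, hence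
  they get no definition.\<close>

lemma best_denom_error_int:
  "\<exists>p::int. of_int (best_denom \<theta> n) * \<theta> - of_int p = (-1) ^ n * approx_error \<theta> n"
proof -
  have "(\<exists>p::int. of_int (best_denom \<theta> n) * \<theta> - of_int p = (-1) ^ n * approx_error \<theta> n) \<and>
    (\<exists>p::int. of_int (best_denom \<theta> (Suc n)) * \<theta> - of_int p = (-1) ^ Suc n * approx_error \<theta> (Suc n))"
  proof (induction n)
    case 0
    \<comment> \<open>The witness is the numerator of the convergent with index 1.\<close>
    have "of_int (best_denom \<theta> (Suc 0)) * \<theta> - of_int (partial_quotient \<theta> 1 * \<lfloor>\<theta>\<rfloor> + 1)
        = (-1) ^ Suc 0 * approx_error \<theta> (Suc 0)"
      by (simp add: approx_error_1 approx_error_0 algebra_simps)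
    moreover have "of_int (best_denom \<theta> 0) * \<theta> - of_int \<lfloor>\<theta>\<rfloor> = (-1) ^ 0 * approx_error \<theta> 0"
      by (simp add: approx_error_0)
    ultimately show ?case by blast
  next
    case (Suc n)
    then obtain p p' :: int where
      p: "of_int (best_denom \<theta> n) * \<theta> - of_int p = (-1) ^ n * approx_error \<theta> n" and
      p': "of_int (best_denom \<theta> (Suc n)) * \<theta> - of_int p' = (-1) ^ Suc n * approx_error \<theta> (Suc n)"
      by blast
    let ?a = "partial_quotient \<theta> (Suc (Suc n))"
    have "of_int (best_denom \<theta> (Suc (Suc n))) * \<theta> - of_int (?a * p' + p)
      = of_int ?a * (of_int (best_denom \<theta> (Suc n)) * \<theta> - of_int p')
        + (of_int (best_denom \<theta> n) * \<theta> - of_int p)"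
      by (simp add: algebra_simps)
    also have "\<dots> = (-1) ^ Suc (Suc n) * approx_error \<theta> (Suc (Suc n))"
      unfolding p p' approx_error_rec by (simp add: algebra_simps)
    finally show ?case using Suc by blast
  qed
  then show ?thesis by blast
qed

text \<open>The left side does not change with \<open>n\<close>: the two terms containing the new
  partial quotient cancel. It is the determinant identity of consecutive convergents.\<close>

lemma approx_error_best_denom:
  "approx_error \<theta> n * of_int (best_denom \<theta> (Suc n)) + approx_error \<theta> (Suc n) * of_int (best_denom \<theta> n) = 1"
proof (induction n)
  case 0
  show ?case by (simp add: approx_error_1)
next
  case (Suc n)
  then show ?case unfolding best_denom_rec approx_error_rec by (simp only: algebra_simps)
qed

lemma approx_error_less: "approx_error \<theta> n * of_int (best_denom \<theta> (Suc n)) < 1"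
proof -
  have "0 < approx_error \<theta> (Suc n) * of_int (best_denom \<theta> n)"
    by (simp add: approx_error_pos best_denom_pos)
  then show ?thesis using approx_error_best_denom[of n] by linarith
qed

text \<open>In \<open>approx_error_best_denom\<close> the second summand is at most the first, as
  errors decrease and denominators do not.\<close>

lemma approx_error_ge: "1 \<le> 2 * approx_error \<theta> n * of_int (best_denom \<theta> (Suc n))"
proof -
  have "approx_error \<theta> (Suc n) * of_int (best_denom \<theta> n)
      \<le> approx_error \<theta> n * of_int (best_denom \<theta> (Suc n))"
    using approx_error_pos[of n] best_denom_pos[of n] best_denom_pos_and_mono[of n]
    by (intro mult_mono less_imp_le[OF approx_error_Suc_less]) auto
  then show ?thesis using approx_error_best_denom[of n] by linarith
qed

lemma irrational_mult_int_neq: "n \<noteq> 0 \<Longrightarrow> of_int n * \<theta> - of_int m \<noteq> 0" for n m :: int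
proof
  assume "n \<noteq> 0" "of_int n * \<theta> - of_int m = 0"
  then have "\<theta> = of_int m / of_int n" by (simp add: field_simps)
  then show False using irrational by simp
qed

section \<open>Bounded ratios of consecutive denominators and bad approximability\<close>

text \<open>If \<open>p/q\<close> is the first convergent whose successor has denominator at least \<open>2n\<close>, then
  either \<open>m/n = p/q\<close>, or the integer \<open>np - mq\<close> has absolute value at least 1.\<close>

lemma linear_form_bound_if_ratio_bounded:
  assumes C: "\<And>k. real_of_int (best_denom \<theta> (Suc k)) \<le> C * of_int (best_denom \<theta> k)"
    and n: "0 < n"
  shows "1 / (8 * C) \<le> of_int n * \<bar>of_int n * \<theta> - of_int m\<bar>"
proof -
  have C1: "1 \<le> C"
  proof -
    have "1 \<le> real_of_int (best_denom \<theta> (Suc 0))" using best_denom_ge_1[of "Suc 0"] by linarith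
    with C[of 0] show ?thesis by simp
  qed
  define k where "k = (LEAST k. 2 * n \<le> best_denom \<theta> (Suc k))"
  have "2 * n \<le> best_denom \<theta> (Suc (nat (2 * n)))"
    using best_denom_ge_index[of "Suc (nat (2 * n))"] n by simp
  then have k: "2 * n \<le> best_denom \<theta> (Suc k)" unfolding k_def by (rule LeastI)
  have k': "best_denom \<theta> k < 2 * n"
  proof (cases k)
    \<comment> \<open>Minimality is void at index 0, but there the denominator is 1.\<close>
    case 0
    then show ?thesis using n by simp
  next
    case (Suc j)
    then have "j < k" by simp
    from not_less_Least[OF this[unfolded k_def]] Suc show ?thesis by simp
  qed
  obtain p where p: "of_int (best_denom \<theta> k) * \<theta> - of_int p = (-1) ^ k * approx_error \<theta> k"
    using best_denom_error_int by blast
  define e where "e = (-1) ^ k * approx_error \<theta> k"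
  define q N M P d where "q = real_of_int (best_denom \<theta> k)" "N = real_of_int n" "M = real_of_int m"
    "P = real_of_int p" "d = \<bar>N * \<theta> - M\<bar>"
  have abs_e: "\<bar>e\<bar> = approx_error \<theta> k"
    using approx_error_pos[of k] by (simp add: e_def abs_mult)
  have pos: "0 < q" "0 < N" "q < 2 * N" "2 * N \<le> real_of_int (best_denom \<theta> (Suc k))" "q * \<theta> - P = e"
    using best_denom_pos[of k] n k k' p unfolding q_N_M_P_d_def e_def by linarith+
  \<comment> \<open>The linear form of \<open>n\<close> is split into the integer
    \<open>n * p - m * q\<close> and the error of the convergent.\<close>
  have key: "q * (N * \<theta> - M) = (N * P - M * q) + N * e"
    unfolding pos(5)[symmetric] by (simp add: algebra_simps)
  show ?thesis
  proof (cases "n * p = m * best_denom \<theta> k")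
    case True
    then have "N * P = M * q"
      unfolding q_N_M_P_d_def by (metis of_int_mult)
    then have "\<bar>q * (N * \<theta> - M)\<bar> = \<bar>N * e\<bar>" using key by simp
    then have qd: "q * d = N * \<bar>e\<bar>" using pos by (simp add: q_N_M_P_d_def(5) abs_mult)
    have "2 * \<bar>e\<bar> * real_of_int (best_denom \<theta> (Suc k)) \<le> 2 * \<bar>e\<bar> * (C * q)"
      by (intro mult_left_mono) (use C[of k] in \<open>auto simp: q_N_M_P_d_def(1)\<close>)
    then have e1: "1 \<le> 2 * C * (q * \<bar>e\<bar>)"
      using approx_error_ge[of k] unfolding abs_e by (simp add: mult_ac)
    \<comment> \<open>The bound \<open>q < 2 * N\<close> is spent twice. Replacing
      \<open>N * \<bar>e\<bar>\<close> by \<open>q * d\<close> at the end lets \<open>q\<close>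
      cancel.\<close>
    have "q * 1 \<le> (2 * N) * 1" using pos by simp
    also have "\<dots> \<le> (2 * N) * (2 * C * (q * \<bar>e\<bar>))"
      by (rule mult_left_mono[OF e1]) (use pos in simp)
    also have "\<dots> = (4 * C * N * \<bar>e\<bar>) * q" by simp
    also have "\<dots> \<le> (4 * C * N * \<bar>e\<bar>) * (2 * N)"
      by (rule mult_left_mono) (use pos C1 in auto)
    also have "\<dots> = q * (8 * C * N * d)" using qd by (simp add: algebra_simps)
    finally have "1 \<le> 8 * C * N * d" using pos by simp
    then show ?thesis using C1 unfolding q_N_M_P_d_def(2,3,5) by (simp add: field_simps)
  next
    case False
    then have "1 \<le> \<bar>n * p - m * best_denom \<theta> k\<bar>" by linarith
    then have "1 \<le> \<bar>real_of_int (n * p - m * best_denom \<theta> k)\<bar>" by linarith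
    then have "1 \<le> \<bar>N * P - M * q\<bar>" unfolding q_N_M_P_d_def by simp
    then have "1 \<le> \<bar>q * (N * \<theta> - M)\<bar> + \<bar>N * e\<bar>" using key by linarith
    then have qd: "1 \<le> q * d + N * \<bar>e\<bar>" using pos by (simp add: q_N_M_P_d_def(5) abs_mult)
    \<comment> \<open>The choice of \<open>k\<close> keeps \<open>N * \<bar>e\<bar>\<close> below
      1/2, so \<open>q * d\<close> exceeds 1/2, and \<open>q < 2 * N\<close> turns this into a bound
      for \<open>N * d\<close>.\<close>
    have "\<bar>e\<bar> * (2 * N) \<le> \<bar>e\<bar> * real_of_int (best_denom \<theta> (Suc k))"
      by (rule mult_left_mono) (use pos in auto)
    with approx_error_less[of k] have "2 * (N * \<bar>e\<bar>) < 1" unfolding abs_e by (simp add: mult_ac)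
    moreover have "q * d \<le> (2 * N) * d"
      by (rule mult_right_mono) (use pos in \<open>auto simp: q_N_M_P_d_def(5)\<close>)
    ultimately have "1 / 4 \<le> N * d" using qd by linarith
    moreover have "1 / (8 * C) \<le> 1 / 4" using C1 by (simp add: field_simps)
    ultimately show ?thesis unfolding q_N_M_P_d_def(2,3,5) by linarith
  qed
qed

text \<open>At \<open>n = best_denom \<theta> k\<close> the product in the liminf is at most the
  quotient of this denominator by the next one, so a positive liminf bounds the ratios. The converse
  is \<open>linear_form_bound_if_ratio_bounded\<close>.\<close>

lemma badly_approximable_iff_ratio_bounded:
  "\<theta> \<in> badly_approximable \<longleftrightarrow>
     (\<exists>C. \<forall>k. real_of_int (best_denom \<theta> (Suc k)) \<le> C * of_int (best_denom \<theta> k))"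
  (is "_ = ?B")
proof
  let ?f = "\<lambda>n. real n * dist_nearest_int (real n * \<theta>)"
  assume "\<theta> \<in> badly_approximable"
  then have "0 < liminf (\<lambda>n. ereal (?f n))" by (simp add: badly_approximable_def)
  then obtain c where c: "0 < ereal c" "ereal c < liminf (\<lambda>n. ereal (?f n))"
    using ereal_dense2 by blast
  from less_LiminfD[OF c(2)] obtain N where N: "\<And>n. N \<le> n \<Longrightarrow> c < ?f n"
    by (auto simp: eventually_sequentially)
  have ratio: "real_of_int (best_denom \<theta> (Suc k)) \<le> (1 / c) * of_int (best_denom \<theta> k)" if "N \<le> k" for k
  proof -
    define n where "n = nat (best_denom \<theta> k)"
    have n: "real n = of_int (best_denom \<theta> k)" using best_denom_pos[of k] by (simp add: n_def)
    obtain p where p: "of_int (best_denom \<theta> k) * \<theta> - of_int p = (-1) ^ k * approx_error \<theta> k"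
      using best_denom_error_int by blast
    have "dist_nearest_int (real n * \<theta>) \<le> \<bar>of_int (best_denom \<theta> k) * \<theta> - of_int p\<bar>"
      unfolding dist_nearest_int_def n by (rule round_diff_minimal)
    also have "\<dots> = approx_error \<theta> k" unfolding p using approx_error_pos[of k] by (simp add: abs_mult)
    finally have "?f n \<le> real n * approx_error \<theta> k" by (simp add: mult_left_mono)
    moreover have "N \<le> n" using that best_denom_ge_index[of k] by (simp add: n_def)
    ultimately have "c \<le> approx_error \<theta> k * real n" using N[of n] by (simp add: mult.commute)
    then have "c * of_int (best_denom \<theta> (Suc k)) \<le> approx_error \<theta> k * real n * of_int (best_denom \<theta> (Suc k))"
      using best_denom_pos[of "Suc k"] by (intro mult_right_mono) auto
    also have "\<dots> = (approx_error \<theta> k * of_int (best_denom \<theta> (Suc k))) * real n" by simp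
    also have "\<dots> \<le> 1 * real n"
      using approx_error_less[of k] by (intro mult_right_mono) auto
    finally show ?thesis using c(1) n by (simp add: field_simps)
  qed
  \<comment> \<open>The second summand covers the finitely many ratios before index
    \<open>N\<close>, whose numerators are at most \<open>best_denom \<theta> N\<close>.\<close>
  define C where "C = 1 / c + of_int (best_denom \<theta> N)"
  have "real_of_int (best_denom \<theta> (Suc k)) \<le> C * of_int (best_denom \<theta> k)" for k
  proof (cases "N \<le> k")
    case True
    have "(1 / c) * of_int (best_denom \<theta> k) \<le> C * of_int (best_denom \<theta> k)"
      using best_denom_pos[of k] best_denom_pos[of N] by (intro mult_right_mono) (auto simp: C_def)
    with ratio[OF True] show ?thesis by linarith
  next
    case False
    then have "real_of_int (best_denom \<theta> (Suc k)) \<le> of_int (best_denom \<theta> N) * 1"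
      using best_denom_mono[of "Suc k" N] by simp
    also have "\<dots> \<le> C * of_int (best_denom \<theta> k)"
      using best_denom_ge_1[of k] best_denom_pos[of N] c(1) by (intro mult_mono) (auto simp: C_def)
    finally show ?thesis .
  qed
  then show ?B by blast
next
  assume ?B
  then obtain C where C: "\<And>k. real_of_int (best_denom \<theta> (Suc k)) \<le> C * of_int (best_denom \<theta> k)"
    by blast
  have "0 < C" using C[of 0] best_denom_pos[of "Suc 0"] by simp
  have "eventually (\<lambda>n. ereal (1 / (8 * C)) \<le> ereal (real n * dist_nearest_int (real n * \<theta>))) sequentially"
    using eventually_gt_at_top[of 0]
  proof eventually_elim
    case (elim n)
    then show ?case
      using linear_form_bound_if_ratio_bounded[OF C, of "int n" "round (real n * \<theta>)"]
      by (simp add: dist_nearest_int_def)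
  qed
  then have "ereal (1 / (8 * C)) \<le> liminf (\<lambda>n. ereal (real n * dist_nearest_int (real n * \<theta>)))"
    by (rule Liminf_bounded)
  moreover have "0 < ereal (1 / (8 * C))" using \<open>0 < C\<close> by simp
  ultimately show "\<theta> \<in> badly_approximable"
    using irrational less_le_trans unfolding badly_approximable_def by blast
qed

text \<open>Negative \<open>n\<close> are reached by changing the signs of both integers;
  hyperintegers of either sign occur in condition (ii).\<close>

lemma badly_approximable_linear_form_bound:
  assumes "\<theta> \<in> badly_approximable"
  obtains c where "0 < c" "\<And>n m :: int. n \<noteq> 0 \<Longrightarrow> c \<le> \<bar>of_int n\<bar> * \<bar>of_int n * \<theta> - of_int m\<bar>"
proof -
  from assms obtain C where C: "\<And>k. real_of_int (best_denom \<theta> (Suc k)) \<le> C * of_int (best_denom \<theta> k)"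
    unfolding badly_approximable_iff_ratio_bounded by blast
  show ?thesis
  proof (rule that)
    show "0 < 1 / (8 * C)" using C[of 0] best_denom_pos[of "Suc 0"] by simp
    show "1 / (8 * C) \<le> \<bar>of_int n\<bar> * \<bar>of_int n * \<theta> - of_int m\<bar>" if "n \<noteq> 0" for n m :: int
    proof (cases "0 < n")
      case True
      then show ?thesis using linear_form_bound_if_ratio_bounded[OF C True, of m] by simp
    next
      case False
      then have "0 < - n" using that by simp
      from linear_form_bound_if_ratio_bounded[OF C this, of "- m"] False show ?thesis
        by (simp add: abs_minus_commute)
    qed
  qed
qed

text \<open>The summand \<open>best_denom \<theta> (Suc i)\<close> in the required ratio forces the index \<open>k i\<close> to exceed \<open>i\<close>.\<close>

lemma large_ratio_indices:
  assumes "\<theta> \<notin> badly_approximable"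
  obtains k :: "nat \<Rightarrow> nat" where "\<And>i. i \<le> k i"
    "\<And>i. real i * of_int (best_denom \<theta> (k i)) < of_int (best_denom \<theta> (Suc (k i)))"
proof -
  have "\<exists>k. i \<le> k \<and> real i * of_int (best_denom \<theta> k) < of_int (best_denom \<theta> (Suc k))" for i :: nat
  proof -
    from assms obtain k where k:
      "(real i + of_int (best_denom \<theta> (Suc i))) * of_int (best_denom \<theta> k) < of_int (best_denom \<theta> (Suc k))"
      unfolding badly_approximable_iff_ratio_bounded by (meson not_le)
    have "of_int (best_denom \<theta> (Suc i)) * 1 \<le> of_int (best_denom \<theta> (Suc i)) * real_of_int (best_denom \<theta> k)"
      using best_denom_ge_1[of k] best_denom_pos[of "Suc i"] by (intro mult_left_mono) auto
    moreover have "0 \<le> real i * of_int (best_denom \<theta> k)" using best_denom_pos[of k] by simp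
    moreover have "0 < best_denom \<theta> (Suc i)" by (rule best_denom_pos)
    ultimately have "best_denom \<theta> (Suc i) < best_denom \<theta> (Suc k)"
      "real i * of_int (best_denom \<theta> k) < of_int (best_denom \<theta> (Suc k))"
      using k unfolding distrib_right by linarith+
    moreover from this(1) have "i \<le> k" using best_denom_mono[of "Suc k" "Suc i"] by (meson not_le not_less_eq_eq linear)
    ultimately show ?thesis by blast
  qed
  then show ?thesis using that by metis
qed

end

section \<open>The ultrapower and its classes\<close>


lemma mem_star_real_iff: "X \<in> star_real U \<longleftrightarrow> (\<exists>x. X = star_class U x)"
  by (auto simp: ultrapower_def)

lemma star_int_cases:
  assumes "N \<in> star_int U"
  obtains n :: "nat \<Rightarrow> int" where "N = star_class U (\<lambda>i. of_int (n i))"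
proof -
  from assms obtain x where x: "N = star_class U x" "\<And>i. x i \<in> \<int>" by (auto simp: ultrapower_def)
  then have "x = (\<lambda>i. of_int \<lfloor>x i\<rfloor>)" by (simp add: fun_eq_iff)
  then show ?thesis using that x(1) by metis
qed

lemma star_class_of_int_mem: "star_class U (\<lambda>i. of_int (n i)) \<in> star_int U"
  by (auto simp: ultrapower_def)

text \<open>Being below every positive real is literally convergence to 0 along \<open>U\<close>, so
  the usual limit rules apply to infinitesimals.\<close>

lemma star_infinitesimal_class:
  "star_class U x \<in> star_infinitesimal U \<longleftrightarrow> (x \<longlongrightarrow> 0) U"
  by (auto simp: star_infinitesimal_def mem_star_real_iff star_map_class star_of_def
      star_less_class tendsto_iff)

section \<open>Equality and order in \<open>PP U\<close> as inequalities between representing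
  sequences\<close>

definition seq_class :: "nat filter \<Rightarrow> (nat \<Rightarrow> real) \<Rightarrow> hyperreal set" where
  "seq_class U x = PP_class U (star_class U x)"

context
  fixes U :: "nat filter"
  assumes ultra: "nonprincipal_ultrafilter U"
begin

lemma not_bot: "U \<noteq> bot"
  using ultra by (simp add: nonprincipal_ultrafilter_def)

lemma eventually_not_iff: "eventually (\<lambda>i. \<not> P i) U \<longleftrightarrow> \<not> eventually P U"
proof
  assume "eventually (\<lambda>i. \<not> P i) U"
  show "\<not> eventually P U"
  proof
    assume "eventually P U"
    with \<open>eventually (\<lambda>i. \<not> P i) U\<close> have "eventually (\<lambda>i. False) U" by eventually_elim simp
    then show False using not_bot by simp
  qed
qed (use ultra in \<open>auto simp: nonprincipal_ultrafilter_def\<close>)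

text \<open>Finiteness gives an upper bound \<open>r\<close>. Not being infinitesimal gives, by the
  ultrafilter dichotomy, a lower bound \<open>s > 0\<close>. The single constant
  \<open>\<bar>r\<bar> + 1 / s\<close> then bounds both the unit and its inverse.\<close>

lemma fin_units_pos_class:
  "star_class U u \<in> fin_units_pos U \<longleftrightarrow>
     (\<exists>C>0. eventually (\<lambda>i. 0 < u i \<and> u i \<le> C \<and> 1 \<le> C * u i) U)"
proof
  assume "star_class U u \<in> fin_units_pos U"
  then obtain r where r: "eventually (\<lambda>i. \<bar>u i\<bar> < r) U" and pos: "eventually (\<lambda>i. 0 < u i) U"
    and "\<not> (u \<longlongrightarrow> 0) U"
    by (auto simp: fin_units_pos_def star_fin_def star_infinitesimal_class star_map_class star_of_def
        star_less_class)
  then obtain s where s: "0 < s" "eventually (\<lambda>i. \<not> \<bar>u i\<bar> < s) U"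
    by (auto simp: tendsto_iff eventually_not_iff)
  from r pos s(2) have "eventually (\<lambda>i. 0 < u i \<and> u i \<le> \<bar>r\<bar> + 1 / s \<and> 1 \<le> (\<bar>r\<bar> + 1 / s) * u i) U"
  proof eventually_elim
    case (elim i)
    have "1 \<le> (1 / s) * u i" using elim s(1) by (simp add: field_simps)
    also have "\<dots> \<le> (\<bar>r\<bar> + 1 / s) * u i" using elim by (intro mult_right_mono) auto
    finally show ?case using elim s(1) by (simp add: add_increasing2)
  qed
  moreover have "0 < \<bar>r\<bar> + 1 / s" using s(1) by (simp add: add_nonneg_pos)
  ultimately show "\<exists>C>0. eventually (\<lambda>i. 0 < u i \<and> u i \<le> C \<and> 1 \<le> C * u i) U" by blast
next
  assume "\<exists>C>0. eventually (\<lambda>i. 0 < u i \<and> u i \<le> C \<and> 1 \<le> C * u i) U"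
  then obtain C where C: "0 < C" "eventually (\<lambda>i. 0 < u i \<and> u i \<le> C \<and> 1 \<le> C * u i) U" by blast
  from C(2) have "eventually (\<lambda>i. \<bar>u i\<bar> < C + 1) U" by eventually_elim auto
  moreover from C(2) have "eventually (\<lambda>i. 0 < u i) U" by eventually_elim auto
  moreover from C(2) have "eventually (\<lambda>i. \<not> \<bar>u i\<bar> < 1 / C) U"
    by eventually_elim (use C(1) in \<open>auto simp: field_simps\<close>)
  then have "\<not> (u \<longlongrightarrow> 0) U"
    using C(1) by (auto simp: tendsto_iff eventually_not_iff intro!: exI[of _ "1 / C"])
  ultimately show "star_class U u \<in> fin_units_pos U"
    by (auto simp: fin_units_pos_def star_fin_def star_infinitesimal_class star_map_class star_of_def
        star_less_class mem_star_real_iff)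
qed

lemma star_nonneg_pos_class: "eventually (\<lambda>i. 0 < x i) U \<Longrightarrow> star_class U x \<in> star_nonneg U"
  by (auto simp: star_nonneg_def mem_star_real_iff star_of_def star_less_class)

text \<open>Multiplication by a unit moves a value by at most a constant factor. Conversely
  \<open>z i / \<bar>x i\<bar>\<close> is the required unit, which is why \<open>x\<close> has to be
  nonzero.\<close>

lemma mem_seq_class_iff:
  assumes x: "eventually (\<lambda>i. x i \<noteq> 0) U"
  shows "Z \<in> seq_class U x \<longleftrightarrow> (\<exists>z. Z = star_class U z \<and>
    (\<exists>C>0. eventually (\<lambda>i. 0 < z i \<and> z i \<le> C * \<bar>x i\<bar> \<and> \<bar>x i\<bar> \<le> C * z i) U))"
    (is "_ = ?R")
proof
  assume "Z \<in> seq_class U x"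
  then obtain V where V: "V \<in> fin_units_pos U" "Z = star_mult U V (star_class U (\<lambda>i. \<bar>x i\<bar>))"
    by (auto simp: seq_class_def PP_class_def orbit_rel_def star_map_class)
  then obtain u where u: "V = star_class U u"
    by (auto simp: fin_units_pos_def star_fin_def mem_star_real_iff)
  with V obtain C where C: "0 < C" "eventually (\<lambda>i. 0 < u i \<and> u i \<le> C \<and> 1 \<le> C * u i) U"
    using fin_units_pos_class by auto
  have "Z = star_class U (\<lambda>i. u i * \<bar>x i\<bar>)" using V u by (simp add: star_map2_class)
  moreover from C(2) x have "eventually (\<lambda>i. 0 < u i * \<bar>x i\<bar> \<and> u i * \<bar>x i\<bar> \<le> C * \<bar>x i\<bar> \<and>
    \<bar>x i\<bar> \<le> C * (u i * \<bar>x i\<bar>)) U"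
  proof eventually_elim
    case (elim i)
    then have "1 * \<bar>x i\<bar> \<le> (C * u i) * \<bar>x i\<bar>" by (intro mult_right_mono) auto
    with elim show ?case by (simp add: mult.assoc mult_right_mono)
  qed
  ultimately show ?R using C(1) by blast
next
  assume ?R
  then obtain z C where z: "Z = star_class U z" "0 < C"
    "eventually (\<lambda>i. 0 < z i \<and> z i \<le> C * \<bar>x i\<bar> \<and> \<bar>x i\<bar> \<le> C * z i) U" by blast
  define u where "u = (\<lambda>i. z i / \<bar>x i\<bar>)"
  have "eventually (\<lambda>i. z i = u i * \<bar>x i\<bar>) U"
    using x by eventually_elim (simp add: u_def)
  then have Z: "Z = star_mult U (star_class U u) (star_class U (\<lambda>i. \<bar>x i\<bar>))"
    using z(1) by (simp add: star_map2_class star_class_eq_iff)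
  from z(3) x have "eventually (\<lambda>i. 0 < u i \<and> u i \<le> C \<and> 1 \<le> C * u i) U"
    by eventually_elim (auto simp: u_def field_simps)
  then have "star_class U u \<in> fin_units_pos U" using z(2) fin_units_pos_class by blast
  moreover have "star_class U (\<lambda>i. \<bar>x i\<bar>) \<in> star_nonneg U"
    by (rule star_nonneg_pos_class) (use x in eventually_elim, simp)
  moreover from z(3) have "eventually (\<lambda>i. 0 < z i) U" by eventually_elim simp
  then have "Z \<in> star_nonneg U" unfolding z(1) by (rule star_nonneg_pos_class)
  ultimately show "Z \<in> seq_class U x"
    using Z by (auto simp: seq_class_def PP_class_def orbit_rel_def star_map_class)
qed

lemma abs_mem_seq_class:
  assumes "eventually (\<lambda>i. x i \<noteq> 0) U"
  shows "star_class U (\<lambda>i. \<bar>x i\<bar>) \<in> seq_class U x"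
proof -
  from assms have "eventually (\<lambda>i. 0 < \<bar>x i\<bar> \<and> \<bar>x i\<bar> \<le> 1 * \<bar>x i\<bar> \<and> \<bar>x i\<bar> \<le> 1 * \<bar>x i\<bar>) U"
    by eventually_elim simp
  then show ?thesis unfolding mem_seq_class_iff[OF assms] using zero_less_one by blast
qed

lemma seq_class_eqI:
  assumes x: "eventually (\<lambda>i. x i \<noteq> 0) U" and y: "eventually (\<lambda>i. y i \<noteq> 0) U"
    and C: "eventually (\<lambda>i. \<bar>x i\<bar> \<le> C * \<bar>y i\<bar>) U" and D: "eventually (\<lambda>i. \<bar>y i\<bar> \<le> D * \<bar>x i\<bar>) U"
  shows "seq_class U x = seq_class U y"
proof -
  \<comment> \<open>Stated for fresh sequences and constants, so that exchanging the roles yields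
    the other inclusion.\<close>
  have sub: "seq_class U x \<subseteq> seq_class U y"
    if x: "eventually (\<lambda>i. x i \<noteq> 0) U" and y: "eventually (\<lambda>i. y i \<noteq> 0) U"
      and C: "eventually (\<lambda>i. \<bar>x i\<bar> \<le> C * \<bar>y i\<bar>) U" and D: "eventually (\<lambda>i. \<bar>y i\<bar> \<le> D * \<bar>x i\<bar>) U"
    for x y C D
  proof
    fix Z assume "Z \<in> seq_class U x"
    then obtain z B where z: "Z = star_class U z" "0 < B"
      "eventually (\<lambda>i. 0 < z i \<and> z i \<le> B * \<bar>x i\<bar> \<and> \<bar>x i\<bar> \<le> B * z i) U"
      unfolding mem_seq_class_iff[OF x] by blast
    \<comment> \<open>\<open>E\<close> absorbs both compositions of bounds; the 1 in the maximum
      keeps it positive whatever the signs of \<open>C\<close> and \<open>D\<close>.\<close>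
    define E where "E = B * max 1 (max C D)"
    have "0 < E" using z(2) by (simp add: E_def)
    have EC: "B * C \<le> E" "B * D \<le> E" using z(2) by (simp_all add: E_def mult_left_mono)
    from z(3) C D have "eventually (\<lambda>i. 0 < z i \<and> z i \<le> E * \<bar>y i\<bar> \<and> \<bar>y i\<bar> \<le> E * z i) U"
    proof eventually_elim
      case (elim i)
      have "z i \<le> B * \<bar>x i\<bar>" using elim by simp
      also have "\<dots> \<le> B * (C * \<bar>y i\<bar>)" using elim z(2) by (intro mult_left_mono) auto
      also have "\<dots> = (B * C) * \<bar>y i\<bar>" by simp
      also have "\<dots> \<le> E * \<bar>y i\<bar>" using EC by (intro mult_right_mono) auto
      finally have 1: "z i \<le> E * \<bar>y i\<bar>" .
      have "\<bar>y i\<bar> \<le> D * \<bar>x i\<bar>" using elim by simp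
      also have "\<dots> \<le> max 1 (max C D) * \<bar>x i\<bar>" by (intro mult_right_mono) auto
      also have "\<dots> \<le> max 1 (max C D) * (B * z i)" using elim by (intro mult_left_mono) auto
      also have "\<dots> = E * z i" by (simp add: E_def)
      finally show ?case using 1 elim by simp
    qed
    then show "Z \<in> seq_class U y" unfolding mem_seq_class_iff[OF y] using z(1) \<open>0 < E\<close> by blast
  qed
  from sub[OF x y C D] sub[OF y x D C] show ?thesis by blast
qed

lemma seq_class_eqD:
  assumes x: "eventually (\<lambda>i. x i \<noteq> 0) U" and y: "eventually (\<lambda>i. y i \<noteq> 0) U"
    and eq: "seq_class U x = seq_class U y"
  obtains C where "0 < C" "eventually (\<lambda>i. \<bar>x i\<bar> \<le> C * \<bar>y i\<bar> \<and> \<bar>y i\<bar> \<le> C * \<bar>x i\<bar>) U"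
proof -
  have "star_class U (\<lambda>i. \<bar>x i\<bar>) \<in> seq_class U y" using abs_mem_seq_class[OF x] eq by simp
  then obtain z C where z: "star_class U (\<lambda>i. \<bar>x i\<bar>) = star_class U z" and C: "0 < C"
    "eventually (\<lambda>i. 0 < z i \<and> z i \<le> C * \<bar>y i\<bar> \<and> \<bar>y i\<bar> \<le> C * z i) U"
    unfolding mem_seq_class_iff[OF y] by blast
  from C(2) z[unfolded star_class_eq_iff]
  have "eventually (\<lambda>i. \<bar>x i\<bar> \<le> C * \<bar>y i\<bar> \<and> \<bar>y i\<bar> \<le> C * \<bar>x i\<bar>) U" by eventually_elim simp
  with C(1) show ?thesis by (rule that)
qed

text \<open>If separation by some factor \<open>C\<close> failed, the ultrafilter would give the
  reverse inequality along \<open>U\<close>, and the two classes would coincide by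
  \<open>seq_class_eqI\<close>.\<close>

lemma seq_class_less_iff:
  assumes x: "eventually (\<lambda>i. x i \<noteq> 0) U" and y: "eventually (\<lambda>i. y i \<noteq> 0) U"
  shows "PP_less U (seq_class U x) (seq_class U y) \<longleftrightarrow>
    (\<forall>C>0. eventually (\<lambda>i. C * \<bar>x i\<bar> < \<bar>y i\<bar>) U)" (is "_ = ?R")
proof
  assume less: "PP_less U (seq_class U x) (seq_class U y)"
  then have "eventually (\<lambda>i. \<bar>x i\<bar> < \<bar>y i\<bar>) U"
    using abs_mem_seq_class[OF x] abs_mem_seq_class[OF y]
    by (auto simp: PP_less_def simp flip: star_less_class)
  then have le: "eventually (\<lambda>i. \<bar>x i\<bar> \<le> 1 * \<bar>y i\<bar>) U" by eventually_elim simp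
  show ?R
  proof (intro allI impI, rule ccontr)
    fix C :: real assume "\<not> eventually (\<lambda>i. C * \<bar>x i\<bar> < \<bar>y i\<bar>) U"
    then have "eventually (\<lambda>i. \<bar>y i\<bar> \<le> C * \<bar>x i\<bar>) U"
      unfolding eventually_not_iff[symmetric] by (simp add: not_less)
    then have "seq_class U x = seq_class U y" using seq_class_eqI[OF x y le] by blast
    then show False using less by (simp add: PP_less_def)
  qed
next
  assume R: ?R
  show "PP_less U (seq_class U x) (seq_class U y)" unfolding PP_less_def
  proof (intro conjI ballI notI)
    assume "seq_class U x = seq_class U y"
    then obtain C where C: "0 < C" "eventually (\<lambda>i. \<bar>x i\<bar> \<le> C * \<bar>y i\<bar> \<and> \<bar>y i\<bar> \<le> C * \<bar>x i\<bar>) U"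
      using seq_class_eqD[OF x y] by blast
    from C(2) R[rule_format, OF C(1)] have "eventually (\<lambda>i. False) U" by eventually_elim simp
    then show False using not_bot by simp
  next
    fix X Y assume "X \<in> seq_class U x" "Y \<in> seq_class U y"
    then obtain v w A B where v: "X = star_class U v" "0 < A"
        "eventually (\<lambda>i. 0 < v i \<and> v i \<le> A * \<bar>x i\<bar> \<and> \<bar>x i\<bar> \<le> A * v i) U"
      and w: "Y = star_class U w" "0 < B"
        "eventually (\<lambda>i. 0 < w i \<and> w i \<le> B * \<bar>y i\<bar> \<and> \<bar>y i\<bar> \<le> B * w i) U"
      unfolding mem_seq_class_iff[OF x] mem_seq_class_iff[OF y] by blast
    \<comment> \<open>Members stay within the factors \<open>A\<close> and \<open>B\<close> of the
      given sequences, so separation by the product orders them.\<close>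
    have "0 < B * A" using v(2) w(2) by simp
    from v(3) w(3) R[rule_format, OF this] have "eventually (\<lambda>i. v i < w i) U"
    proof eventually_elim
      case (elim i)
      have "B * v i \<le> B * (A * \<bar>x i\<bar>)" using elim w(2) by (intro mult_left_mono) auto
      also have "\<dots> < B * w i" using elim by (simp add: mult.assoc)
      finally show ?case using w(2) by simp
    qed
    then show "star_less U X Y" unfolding v(1) w(1) star_less_class .
  qed
qed

lemma seq_class_leD:
  assumes x: "eventually (\<lambda>i. x i \<noteq> 0) U" and y: "eventually (\<lambda>i. y i \<noteq> 0) U"
    and le: "PP_le U (seq_class U x) (seq_class U y)"
  obtains C where "0 < C" "eventually (\<lambda>i. \<bar>x i\<bar> \<le> C * \<bar>y i\<bar>) U"
proof -
  from le consider "seq_class U x = seq_class U y" | "PP_less U (seq_class U x) (seq_class U y)"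
    by (auto simp: PP_le_def)
  then show ?thesis
  proof cases
    case 1
    with seq_class_eqD[OF x y] obtain C
      where C: "0 < C" "eventually (\<lambda>i. \<bar>x i\<bar> \<le> C * \<bar>y i\<bar> \<and> \<bar>y i\<bar> \<le> C * \<bar>x i\<bar>) U" by blast
    show ?thesis by (rule that[OF C(1)]) (use C(2) in eventually_elim, simp)
  next
    case 2
    then have "eventually (\<lambda>i. 1 * \<bar>x i\<bar> < \<bar>y i\<bar>) U"
      using seq_class_less_iff[OF x y] zero_less_one by blast
    then have "eventually (\<lambda>i. \<bar>x i\<bar> \<le> 1 * \<bar>y i\<bar>) U" by eventually_elim simp
    then show ?thesis using that zero_less_one by blast
  qed
qed

text \<open>No sign is asked of \<open>x\<close>, since \<open>PP_class\<close> takes absolute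
  values.\<close>

lemma PP_eps_iff:
  "\<mu> \<in> PP_eps U \<longleftrightarrow> (\<exists>x. \<mu> = seq_class U x \<and> eventually (\<lambda>i. x i \<noteq> 0) U \<and> (x \<longlongrightarrow> 0) U)"
proof
  assume "\<mu> \<in> PP_eps U"
  then obtain X where X: "X \<in> star_infinitesimal U" "star_less U (star_of U 0) X" "\<mu> = PP_class U X"
    by (auto simp: PP_eps_def)
  then obtain x where x: "X = star_class U x" by (auto simp: star_infinitesimal_def mem_star_real_iff)
  have "eventually (\<lambda>i. 0 < x i) U" using X by (simp add: x star_of_def star_less_class)
  then have "eventually (\<lambda>i. x i \<noteq> 0) U" by eventually_elim simp
  then show "\<exists>x. \<mu> = seq_class U x \<and> eventually (\<lambda>i. x i \<noteq> 0) U \<and> (x \<longlongrightarrow> 0) U"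
    using X by (auto simp: x star_infinitesimal_class seq_class_def)
next
  assume "\<exists>x. \<mu> = seq_class U x \<and> eventually (\<lambda>i. x i \<noteq> 0) U \<and> (x \<longlongrightarrow> 0) U"
  then obtain x where x: "\<mu> = seq_class U x" "eventually (\<lambda>i. x i \<noteq> 0) U" "(x \<longlongrightarrow> 0) U" by blast
  let ?X = "star_class U (\<lambda>i. \<bar>x i\<bar>)"
  have pos: "eventually (\<lambda>i. 0 < \<bar>x i\<bar>) U" using x(2) by eventually_elim simp
  have "\<mu> = PP_class U ?X" by (simp add: x(1) seq_class_def PP_class_def star_map_class)
  moreover have "\<mu> \<in> PP U"
    using star_nonneg_pos_class[OF pos]
    by (auto simp: x(1) seq_class_def PP_class_def PP_def star_map_class intro: quotientI)
  moreover have "?X \<in> star_infinitesimal U"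
    using x(3) by (simp add: star_infinitesimal_class tendsto_rabs_zero_iff)
  moreover have "star_less U (star_of U 0) ?X" using pos by (simp add: star_of_def star_less_class)
  ultimately show "\<mu> \<in> PP_eps U" by (auto simp: PP_eps_def)
qed

section \<open>Growth, decay and admissible index sequences\<close>

lemma growth_class: "growth U (star_class U n) = seq_class U (\<lambda>i. inverse (n i))"
  by (simp add: growth_def seq_class_def star_map_class)

lemma star_int_approx_iff:
  "star_class U n \<in> star_int_approx U \<theta> \<longleftrightarrow> star_class U n \<in> star_int U \<and>
     (\<exists>m :: nat \<Rightarrow> int. ((\<lambda>i. n i * \<theta> - of_int (m i)) \<longlongrightarrow> 0) U)"
proof -
  have "star_minus U (star_mult U (star_class U n) (star_of U \<theta>)) (star_class U (\<lambda>i. of_int (m i)))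
      \<in> star_infinitesimal U \<longleftrightarrow> ((\<lambda>i. n i * \<theta> - of_int (m i)) \<longlongrightarrow> 0) U" for m :: "nat \<Rightarrow> int"
    by (simp add: star_of_def star_map2_class star_infinitesimal_class)
  then show ?thesis
    unfolding star_int_approx_def by (auto elim!: star_int_cases intro: star_class_of_int_mem)
qed

text \<open>Two choices of the nearby hyperinteger differ by an infinitesimal integer sequence,
  which vanishes along \<open>U\<close>. Hence \<open>perp\<close> is well defined and any suitable
  \<open>m\<close> computes the decay.\<close>

lemma decay_class:
  fixes m :: "nat \<Rightarrow> int"
  assumes lim: "((\<lambda>i. n i * \<theta> - of_int (m i)) \<longlongrightarrow> 0) U"
  shows "decay U \<theta> (star_class U n) = seq_class U (\<lambda>i. n i * \<theta> - of_int (m i))"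
proof -
  have "perp U \<theta> (star_class U n) = star_class U (\<lambda>i. of_int (m i))"
    unfolding perp_def
  proof (rule the_equality)
    show "star_class U (\<lambda>i. of_int (m i)) \<in> star_int U \<and>
      star_minus U (star_mult U (star_class U n) (star_of U \<theta>)) (star_class U (\<lambda>i. of_int (m i)))
        \<in> star_infinitesimal U"
      using lim star_class_of_int_mem by (simp add: star_of_def star_map2_class star_infinitesimal_class)
  next
    fix M assume M: "M \<in> star_int U \<and>
      star_minus U (star_mult U (star_class U n) (star_of U \<theta>)) M \<in> star_infinitesimal U"
    then obtain l :: "nat \<Rightarrow> int" where l: "M = star_class U (\<lambda>i. of_int (l i))"
      using star_int_cases by blast
    with M have "((\<lambda>i. n i * \<theta> - of_int (l i)) \<longlongrightarrow> 0) U"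
      by (simp add: star_of_def star_map2_class star_infinitesimal_class)
    from tendsto_diff[OF lim this] have "((\<lambda>i. real_of_int (l i - m i)) \<longlongrightarrow> 0) U" by simp
    then have "eventually (\<lambda>i. \<bar>real_of_int (l i - m i)\<bar> < 1) U"
      unfolding tendsto_iff by (auto dest: spec[of _ 1])
    then have "eventually (\<lambda>i. real_of_int (l i) = of_int (m i)) U"
    proof eventually_elim
      case (elim i)
      then have "\<bar>l i - m i\<bar> < 1" by linarith
      then show ?case by simp
    qed
    then show "M = star_class U (\<lambda>i. of_int (m i))" unfolding l star_class_eq_iff .
  qed
  then show ?thesis
    by (simp add: decay_def error_term_def seq_class_def star_of_def star_map2_class)
qed

text \<open>Either the even or the odd indices form a set of the ultrafilter; on the other parity class
  the sequence can be overwritten by its preceding value.\<close>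

lemma best_index_modification:
  assumes n: "filterlim n at_top U"
  obtains n' where "best_index U n'" "eventually (\<lambda>i. n' i = n i) U"
proof -
  obtain b where b: "eventually (\<lambda>i. even i = b) U"
    using that[of True] that[of False] eventually_not_iff[of even] by (cases "eventually even U") auto
  define n' where "n' = (\<lambda>i. if even i = b then n i else n (i - 1))"
  have eq: "eventually (\<lambda>i. n' i = n i) U" using b by eventually_elim (simp add: n'_def)
  \<comment> \<open>At an index \<open>i\<close> of the chosen parity, \<open>Suc i\<close> has the
    other one, so both values equal \<open>n i\<close>.\<close>
  have "eventually (\<lambda>i. n' i \<le> n' (Suc i)) U" using b by eventually_elim (auto simp: n'_def)
  moreover have "filterlim n' at_top U" using n eq by (simp add: filterlim_cong)
  ultimately have "best_index U n'" by (simp add: best_index_def)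
  then show ?thesis using eq by (rule that)
qed

end

section \<open>Best denominator classes\<close>

context
  fixes U :: "nat filter" and \<theta> :: real
  assumes ultra: "nonprincipal_ultrafilter U" and irrational: "\<theta> \<notin> \<rat>"
begin

lemma inverse_best_denom_nonzero: "eventually (\<lambda>i. inverse (real_of_int (best_denom \<theta> (n i))) \<noteq> 0) U"
proof (rule always_eventually, rule allI)
  show "inverse (real_of_int (best_denom \<theta> (n i))) \<noteq> 0" for i
    using best_denom_pos[OF irrational, of "n i"] by simp
qed

lemma approx_error_nonzero: "eventually (\<lambda>i. approx_error \<theta> (n i) \<noteq> 0) U"
  by (rule always_eventually) (use approx_error_pos[OF irrational] in \<open>auto simp: less_le\<close>)

lemma inverse_best_denom_tendsto:
  assumes "filterlim n at_top U"
  shows "((\<lambda>i. inverse (real_of_int (best_denom \<theta> (n i)))) \<longlongrightarrow> 0) U"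
proof -
  have "filterlim (\<lambda>i. real (n i)) at_top U"
    by (rule filterlim_compose[OF filterlim_real_sequentially assms])
  then have "filterlim (\<lambda>i. real_of_int (best_denom \<theta> (n i))) at_top U"
  proof (rule filterlim_at_top_mono)
    have "real (n i) \<le> of_int (best_denom \<theta> (n i))" for i
      using best_denom_ge_index[OF irrational, of "n i"] by linarith
    then show "eventually (\<lambda>i. real (n i) \<le> of_int (best_denom \<theta> (n i))) U" by simp
  qed
  then show ?thesis by (rule tendsto_inverse_0_at_top)
qed

lemma approx_error_le_inverse: "approx_error \<theta> k \<le> inverse (of_int (best_denom \<theta> (Suc k)))"
  using approx_error_less[OF irrational, of k] best_denom_pos[OF irrational, of "Suc k"]
  by (simp add: field_simps)

lemma approx_error_tendsto:
  assumes "filterlim n at_top U"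
  shows "((\<lambda>i. approx_error \<theta> (n i)) \<longlongrightarrow> 0) U"
proof (rule tendsto_sandwich[OF _ _ tendsto_const inverse_best_denom_tendsto])
  show "eventually (\<lambda>i. 0 \<le> approx_error \<theta> (n i)) U"
    using approx_error_pos[OF irrational] by (simp add: less_imp_le)
  show "eventually (\<lambda>i. approx_error \<theta> (n i) \<le> inverse (real_of_int (best_denom \<theta> (Suc (n i))))) U"
    using approx_error_le_inverse by simp
  show "filterlim (\<lambda>i. Suc (n i)) at_top U"
    using filterlim_Suc assms by (rule filterlim_compose)
qed

lemma growth_best_denom_class:
  "growth U (best_denom_class U \<theta> n) = seq_class U (\<lambda>i. inverse (of_int (best_denom \<theta> (n i))))"
  unfolding best_denom_class_def growth_class[OF ultra] ..

text \<open>The numerators of the convergents serve as the nearby integers, and the alternating sign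
  of the error disappears in \<open>PP U\<close>.\<close>

lemma decay_best_denom_class:
  assumes n: "filterlim n at_top U"
  shows "best_denom_class U \<theta> n \<in> star_int_approx U \<theta>"
    and "decay U \<theta> (best_denom_class U \<theta> n) = seq_class U (\<lambda>i. approx_error \<theta> (n i))"
proof -
  obtain p where p: "\<And>k. of_int (best_denom \<theta> k) * \<theta> - of_int (p k) = (-1) ^ k * approx_error \<theta> k"
    using best_denom_error_int[OF irrational] by metis
  have abs: "\<bar>(-1) ^ n i * approx_error \<theta> (n i)\<bar> = \<bar>approx_error \<theta> (n i)\<bar>" for i
    by (simp add: abs_mult)
  have lim: "((\<lambda>i. of_int (best_denom \<theta> (n i)) * \<theta> - of_int (p (n i))) \<longlongrightarrow> 0) U"
    unfolding p by (subst tendsto_rabs_zero_iff[symmetric], unfold abs, subst tendsto_rabs_zero_iff)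
      (rule approx_error_tendsto[OF n])
  show "best_denom_class U \<theta> n \<in> star_int_approx U \<theta>"
    unfolding best_denom_class_def star_int_approx_iff[OF ultra]
    using star_class_of_int_mem[of U "\<lambda>i. best_denom \<theta> (n i)"] lim
      exI[of "\<lambda>m :: nat \<Rightarrow> int. ((\<lambda>i. of_int (best_denom \<theta> (n i)) * \<theta> - of_int (m i)) \<longlongrightarrow> 0) U" "\<lambda>i. p (n i)"]
    by simp
  have "decay U \<theta> (best_denom_class U \<theta> n) = seq_class U (\<lambda>i. (-1) ^ n i * approx_error \<theta> (n i))"
    unfolding best_denom_class_def decay_class[OF ultra lim] p ..
  also have "\<dots> = seq_class U (\<lambda>i. approx_error \<theta> (n i))"
    using approx_error_nonzero[of n]
    by (intro seq_class_eqI[OF ultra, where C = 1 and D = 1]) (simp_all add: abs_mult)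
  finally show "decay U \<theta> (best_denom_class U \<theta> n) = seq_class U (\<lambda>i. approx_error \<theta> (n i))" .
qed

lemma best_growths_subset: "best_growths U \<theta> \<subseteq> PP_eps U"
proof
  fix \<mu> assume "\<mu> \<in> best_growths U \<theta>"
  then obtain n where n: "best_index U n" "\<mu> = growth U (best_denom_class U \<theta> n)"
    by (auto simp: best_growths_def)
  then show "\<mu> \<in> PP_eps U"
    unfolding PP_eps_iff[OF ultra] growth_best_denom_class best_index_def
    using inverse_best_denom_nonzero inverse_best_denom_tendsto by blast
qed

text \<open>Ratios exceeding \<open>i\<close> at position \<open>i\<close> exceed every constant
  along \<open>U\<close>, because \<open>U\<close> refines the cofinite filter. This class with an
  infinitely larger successor is the common counterexample to (ii), (iii) and (iv).\<close>

lemma not_badly_approximable_index: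
  assumes "\<theta> \<notin> badly_approximable"
  obtains k where "best_index U k"
    "\<And>C. eventually (\<lambda>i. C * of_int (best_denom \<theta> (k i)) < real_of_int (best_denom \<theta> (Suc (k i)))) U"
proof -
  obtain l :: "nat \<Rightarrow> nat" where l: "\<And>i. i \<le> l i"
    "\<And>i. real i * of_int (best_denom \<theta> (l i)) < of_int (best_denom \<theta> (Suc (l i)))"
    using large_ratio_indices[OF irrational assms] by blast
  have U: "U \<le> sequentially" by (rule nonprincipal_ultrafilter_le_sequentially[OF ultra])
  have "filterlim l at_top sequentially"
    by (rule filterlim_at_top_mono[OF filterlim_ident]) (simp add: l(1))
  then have "filterlim l at_top U" using U by (blast intro: filterlim_mono)
  then obtain k where k: "best_index U k" "eventually (\<lambda>i. k i = l i) U"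
    using best_index_modification[OF ultra] by blast
  show ?thesis
  proof (rule that[OF k(1)])
    fix C :: real
    have "eventually (\<lambda>i. C \<le> real i) sequentially"
      using filterlim_real_sequentially by (simp add: filterlim_at_top)
    then have "eventually (\<lambda>i. C \<le> real i) U" using U by (simp add: filter_leD)
    with k(2) show "eventually (\<lambda>i. C * of_int (best_denom \<theta> (k i)) < real_of_int (best_denom \<theta> (Suc (k i)))) U"
    proof eventually_elim
      case (elim i)
      have "C * of_int (best_denom \<theta> (l i)) \<le> real i * of_int (best_denom \<theta> (l i))"
        using elim best_denom_pos[OF irrational, of "l i"] by (intro mult_right_mono) auto
      with l(2)[of i] elim show ?case by simp
    qed
  qed
qed

section \<open>Triviality of the growth-decay groups, condition (ii)\<close>

lemma growth_decay_group_trivial: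
  assumes bad: "\<theta> \<in> badly_approximable"
    and mem: "\<mu> \<in> PP_eps U" "\<nu> \<in> PP_eps U" and le: "PP_le U \<nu> \<mu>"
  shows "growth_decay_group U \<theta> \<mu> \<nu> = {star_of U 0}"
proof -
  have False if N: "N \<in> star_int_approx U \<theta>" "N \<noteq> star_of U 0" "PP_less U \<mu> (growth U N)"
    "PP_le U (decay U \<theta> N) \<nu>" for N
  proof -
    obtain c where c: "0 < c" "\<And>n m :: int. n \<noteq> 0 \<Longrightarrow> c \<le> \<bar>of_int n\<bar> * \<bar>of_int n * \<theta> - of_int m\<bar>"
      using badly_approximable_linear_form_bound[OF irrational bad] by metis
    from N(1) have "N \<in> star_int U" by (simp add: star_int_approx_def)
    then obtain n :: "nat \<Rightarrow> int" where n: "N = star_class U (\<lambda>i. of_int (n i))"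
      using star_int_cases by blast
    have "eventually (\<lambda>i. \<not> real_of_int (n i) = 0) U"
      using N(2) unfolding n star_of_def star_class_eq_iff eventually_not_iff[OF ultra] .
    then have nz: "eventually (\<lambda>i. n i \<noteq> 0) U" by eventually_elim simp
    from N(1) obtain m :: "nat \<Rightarrow> int" where m: "((\<lambda>i. of_int (n i) * \<theta> - of_int (m i)) \<longlongrightarrow> 0) U"
      unfolding n star_int_approx_iff[OF ultra] by blast
    define e where "e = (\<lambda>i. of_int (n i) * \<theta> - of_int (m i))"
    have e: "eventually (\<lambda>i. e i \<noteq> 0) U" unfolding e_def
      using nz by eventually_elim (rule irrational_mult_int_neq[OF irrational])
    have inv: "eventually (\<lambda>i. inverse (real_of_int (n i)) \<noteq> 0) U"
      using nz by eventually_elim simp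
    have decay: "decay U \<theta> N = seq_class U e" unfolding n e_def by (rule decay_class[OF ultra m])
    obtain x where x: "\<mu> = seq_class U x" "eventually (\<lambda>i. x i \<noteq> 0) U"
      using mem unfolding PP_eps_iff[OF ultra] by blast
    obtain y where y: "\<nu> = seq_class U y" "eventually (\<lambda>i. y i \<noteq> 0) U"
      using mem unfolding PP_eps_iff[OF ultra] by blast
    obtain A where A: "0 < A" "eventually (\<lambda>i. \<bar>e i\<bar> \<le> A * \<bar>y i\<bar>) U"
      using seq_class_leD[OF ultra e y(2)] N(4) unfolding decay y(1) by blast
    obtain B where B: "0 < B" "eventually (\<lambda>i. \<bar>y i\<bar> \<le> B * \<bar>x i\<bar>) U"
      using seq_class_leD[OF ultra y(2) x(2)] le unfolding x(1) y(1) by blast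
    have less: "\<forall>C>0. eventually (\<lambda>i. C * \<bar>x i\<bar> < \<bar>inverse (real_of_int (n i))\<bar>) U"
      using N(3) unfolding x(1) n growth_class[OF ultra] seq_class_less_iff[OF ultra x(2) inv] .
    \<comment> \<open>With this constant the growth condition gives
      \<open>A * B * \<bar>x i\<bar> < c / \<bar>n i\<bar>\<close>. The error is at most the left
      side, so the product of \<open>\<bar>n i\<bar>\<close> and the error falls below the lower
      bound \<open>c\<close>.\<close>
    have "0 < A * B / c" using A B c by simp
    from less[rule_format, OF this] A(2) B(2) nz have "eventually (\<lambda>i. False) U"
    proof eventually_elim
      case (elim i)
      have "A * \<bar>y i\<bar> \<le> A * (B * \<bar>x i\<bar>)" using elim A(1) by (intro mult_left_mono) auto
      then have "\<bar>e i\<bar> \<le> A * B * \<bar>x i\<bar>" using elim by simp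
      also have "A * B * \<bar>x i\<bar> < c * inverse \<bar>real_of_int (n i)\<bar>"
        using elim(1) c(1) by (simp add: field_simps)
      finally have "\<bar>of_int (n i)\<bar> * \<bar>e i\<bar> < c" using elim(4) by (simp add: field_simps)
      with c(2)[OF elim(4), of "m i"] show False by (simp add: e_def)
    qed
    then show False using not_bot[OF ultra] by simp
  qed
  then show ?thesis unfolding growth_decay_group_def by blast
qed

text \<open>The decay of the class from \<open>not_badly_approximable_index\<close> serves as both
  parameters. It is comparable to the inverse of the successor, hence strictly below the growth, and
  the class itself is a nonzero element.\<close>

lemma growth_decay_group_nontrivial:
  assumes "\<theta> \<notin> badly_approximable"
  obtains \<mu> where "\<mu> \<in> PP_eps U" "growth_decay_group U \<theta> \<mu> \<mu> \<noteq> {star_of U 0}"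
proof -
  obtain k where k: "best_index U k"
    "\<And>C. eventually (\<lambda>i. C * of_int (best_denom \<theta> (k i)) < real_of_int (best_denom \<theta> (Suc (k i)))) U"
    using not_badly_approximable_index[OF assms] by blast
  then have lim: "filterlim k at_top U" by (simp add: best_index_def)
  define \<mu> where "\<mu> = seq_class U (\<lambda>i. approx_error \<theta> (k i))"
  let ?N = "best_denom_class U \<theta> k"
  show ?thesis
  proof (rule that)
    show "\<mu> \<in> PP_eps U" unfolding PP_eps_iff[OF ultra] \<mu>_def
      using approx_error_nonzero approx_error_tendsto[OF lim] by blast
    have "PP_less U \<mu> (growth U ?N)"
      unfolding \<mu>_def growth_best_denom_class
        seq_class_less_iff[OF ultra approx_error_nonzero inverse_best_denom_nonzero]
    proof (intro allI impI)
      fix C :: real assume "0 < C"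
      from k(2)[of C]
      show "eventually (\<lambda>i. C * \<bar>approx_error \<theta> (k i)\<bar> < \<bar>inverse (real_of_int (best_denom \<theta> (k i)))\<bar>) U"
      proof eventually_elim
        case (elim i)
        have "C * approx_error \<theta> (k i) \<le> C * inverse (of_int (best_denom \<theta> (Suc (k i))))"
          using \<open>0 < C\<close> approx_error_le_inverse by (intro mult_left_mono) auto
        also have "\<dots> < inverse (of_int (best_denom \<theta> (k i)))"
          using elim best_denom_pos[OF irrational, of "k i"] best_denom_pos[OF irrational, of "Suc (k i)"]
          by (simp add: field_simps)
        finally show ?case
          using approx_error_pos[OF irrational, of "k i"] best_denom_pos[OF irrational, of "k i"] by simp
      qed
    qed
    moreover have "PP_le U (decay U \<theta> ?N) \<mu>"
      unfolding decay_best_denom_class(2)[OF lim] \<mu>_def by (simp add: PP_le_def)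
    moreover have "?N \<noteq> star_of U 0"
    proof
      assume "?N = star_of U 0"
      then have "eventually (\<lambda>i. best_denom \<theta> (k i) = 0) U"
        by (simp add: best_denom_class_def star_of_def star_class_eq_iff)
      then have "eventually (\<lambda>i. False) U"
        by eventually_elim (use best_denom_pos[OF irrational] in \<open>auto simp: less_le\<close>)
      then show False using not_bot[OF ultra] by simp
    qed
    ultimately show "growth_decay_group U \<theta> \<mu> \<mu> \<noteq> {star_of U 0}"
      using decay_best_denom_class(1)[OF lim] unfolding growth_decay_group_def by blast
  qed
qed

section \<open>Best growths exhausting the infinitesimal classes, condition (iii)\<close>

lemma badly_approximable_best_growths:
  assumes "\<theta> \<in> badly_approximable"
  shows "best_growths U \<theta> = PP_eps U"
proof (rule antisym[OF best_growths_subset], rule subsetI)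
  fix \<mu> assume "\<mu> \<in> PP_eps U"
  then obtain x where x: "\<mu> = seq_class U x" "eventually (\<lambda>i. x i \<noteq> 0) U" "(x \<longlongrightarrow> 0) U"
    unfolding PP_eps_iff[OF ultra] by blast
  from assms obtain C where C: "\<And>k. real_of_int (best_denom \<theta> (Suc k)) \<le> C * of_int (best_denom \<theta> k)"
    unfolding badly_approximable_iff_ratio_bounded[OF irrational] by blast
  \<comment> \<open>The successor in the condition makes \<open>l i\<close> the index of the last
    denominator not above \<open>inverse \<bar>x i\<bar>\<close>. The next one lies above it and is
    at most \<open>C\<close> times larger.\<close>
  define l where "l = (\<lambda>i. LEAST k. inverse \<bar>x i\<bar> < of_int (best_denom \<theta> (Suc k)))"
  have l1: "inverse \<bar>x i\<bar> < of_int (best_denom \<theta> (Suc (l i)))" for i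
  proof -
    obtain k where "inverse \<bar>x i\<bar> < real k" using reals_Archimedean2 by blast
    also have "real k \<le> of_int (best_denom \<theta> (Suc k))"
      using best_denom_ge_index[OF irrational, of "Suc k"] by linarith
    finally show ?thesis unfolding l_def by (rule LeastI)
  qed
  have l2: "of_int (best_denom \<theta> (l i)) \<le> inverse \<bar>x i\<bar>" if "\<bar>x i\<bar> < 1" "x i \<noteq> 0" for i
  proof (cases "l i")
    \<comment> \<open>Minimality gives nothing at index 0; there the denominator 1 is compared with
      \<open>\<bar>x i\<bar> < 1\<close>.\<close>
    case 0
    then show ?thesis using that by (simp add: one_le_inverse)
  next
    case (Suc j)
    then have "j < l i" by simp
    from not_less_Least[OF this[unfolded l_def]] Suc show ?thesis by simp
  qed
  have lim: "filterlim l at_top U" unfolding filterlim_at_top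
  proof
    fix M
    have "0 < inverse (real_of_int (best_denom \<theta> M))" using best_denom_pos[OF irrational, of M] by simp
    with x(3) have "eventually (\<lambda>i. \<bar>x i\<bar> < inverse (of_int (best_denom \<theta> M))) U"
      unfolding tendsto_iff by (auto dest: spec)
    with x(2) show "eventually (\<lambda>i. M \<le> l i) U"
    proof eventually_elim
      case (elim i)
      show ?case
      proof (rule ccontr)
        assume "\<not> M \<le> l i"
        then have "best_denom \<theta> (Suc (l i)) \<le> best_denom \<theta> M" by (intro best_denom_mono[OF irrational]) simp
        then have "inverse \<bar>x i\<bar> < of_int (best_denom \<theta> M)" using l1[of i] by linarith
        then show False using elim best_denom_pos[OF irrational, of M] by (simp add: field_simps)
      qed
    qed
  qed
  \<comment> \<open>The indices \<open>l i\<close> tend to infinity along \<open>U\<close> but need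
    not satisfy the monotonicity condition.\<close>
  then obtain n where n: "best_index U n" "eventually (\<lambda>i. n i = l i) U"
    using best_index_modification[OF ultra] by blast
  have "eventually (\<lambda>i. \<bar>x i\<bar> < 1) U"
    using x(3) unfolding tendsto_iff by (auto dest: spec[of _ 1])
  with x(2) n(2) have both: "eventually (\<lambda>i. \<bar>x i\<bar> \<le> 1 * \<bar>inverse (real_of_int (best_denom \<theta> (n i)))\<bar> \<and>
    \<bar>inverse (real_of_int (best_denom \<theta> (n i)))\<bar> \<le> C * \<bar>x i\<bar>) U"
  proof eventually_elim
    case (elim i)
    have pos: "0 < real_of_int (best_denom \<theta> (l i))" using best_denom_pos[OF irrational, of "l i"] by simp
    have "\<bar>x i\<bar> \<le> inverse (of_int (best_denom \<theta> (l i)))"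
      using l2[of i] elim pos by (simp add: field_simps)
    moreover have "inverse \<bar>x i\<bar> \<le> C * of_int (best_denom \<theta> (l i))" using l1[of i] C[of "l i"] by linarith
    then have "inverse (of_int (best_denom \<theta> (l i))) \<le> C * \<bar>x i\<bar>"
      using elim pos by (simp add: field_simps)
    ultimately show ?case using elim pos by simp
  qed
  have "\<mu> = growth U (best_denom_class U \<theta> n)" unfolding x(1) growth_best_denom_class
    using seq_class_eqI[OF ultra x(2) inverse_best_denom_nonzero, of 1 n C] both
    unfolding eventually_conj_iff by simp
  then show "\<mu> \<in> best_growths U \<theta>" using n(1) by (auto simp: best_growths_def)
qed

text \<open>When \<open>q\<^sup>+/q\<close> is infinite, the class of \<open>1/sqrt (q q\<^sup>+)\<close> lies strictly between two consecutive
  best growths.\<close>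

lemma best_growths_badly_approximable:
  assumes eq: "best_growths U \<theta> = PP_eps U"
  shows "\<theta> \<in> badly_approximable"
proof (rule ccontr)
  assume "\<theta> \<notin> badly_approximable"
  then obtain k where k: "best_index U k"
    "\<And>C. eventually (\<lambda>i. C * of_int (best_denom \<theta> (k i)) < real_of_int (best_denom \<theta> (Suc (k i)))) U"
    using not_badly_approximable_index by blast
  then have lim: "filterlim k at_top U" by (simp add: best_index_def)
  define q where "q = (\<lambda>j. real_of_int (best_denom \<theta> j))"
  have q_pos: "0 < q j" for j using best_denom_pos[OF irrational, of j] by (simp add: q_def)
  have q_mono: "i \<le> j \<Longrightarrow> q i \<le> q j" for i j using best_denom_mono[OF irrational, of i j] by (simp add: q_def)
  define x where "x = (\<lambda>i. inverse (sqrt (q (k i) * q (Suc (k i)))))"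
  have x_pos: "0 < x i" for i using q_pos by (simp add: x_def)
  have x_nz: "eventually (\<lambda>i. x i \<noteq> 0) U" using x_pos by (simp add: less_le)
  have "(x \<longlongrightarrow> 0) U"
  proof (rule tendsto_sandwich[OF _ _ tendsto_const inverse_best_denom_tendsto[OF lim]])
    show "eventually (\<lambda>i. 0 \<le> x i) U" using x_pos by (simp add: less_imp_le)
    have "q (k i) \<le> sqrt (q (k i) * q (Suc (k i)))" for i
      using q_pos[of "k i"] q_mono[of "k i" "Suc (k i)"]
      by (intro real_le_rsqrt) (simp add: power2_eq_square mult_left_mono)
    then have "x i \<le> inverse (q (k i))" for i
      using q_pos unfolding x_def by (intro le_imp_inverse_le) auto
    then show "eventually (\<lambda>i. x i \<le> inverse (real_of_int (best_denom \<theta> (k i)))) U"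
      by (simp add: q_def)
  qed
  with x_nz have "seq_class U x \<in> PP_eps U" unfolding PP_eps_iff[OF ultra] by blast
  with eq obtain m where m: "seq_class U x = seq_class U (\<lambda>i. inverse (of_int (best_denom \<theta> (m i))))"
    by (auto simp: best_growths_def growth_best_denom_class)
  obtain C where C: "0 < C" "eventually (\<lambda>i. \<bar>x i\<bar> \<le> C * \<bar>inverse (real_of_int (best_denom \<theta> (m i)))\<bar> \<and>
      \<bar>inverse (real_of_int (best_denom \<theta> (m i)))\<bar> \<le> C * \<bar>x i\<bar>) U"
    using seq_class_eqD[OF ultra x_nz inverse_best_denom_nonzero m] by blast
  \<comment> \<open>Comparability within \<open>C\<close> is squared below, since \<open>s\<close>
    is the geometric mean of \<open>a\<close> and \<open>b\<close>; hence a ratio beyond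
    \<open>C\<^sup>2\<close> is called for.\<close>
  from C(2) k(2)[of "C\<^sup>2"] have "eventually (\<lambda>i. False) U"
  proof eventually_elim
    case (elim i)
    define a b s t where "a = q (k i)" "b = q (Suc (k i))" "s = sqrt (a * b)" "t = q (m i)"
    have pos: "0 < a" "0 < b" "0 < s" "0 < t" using q_pos by (simp_all add: a_b_s_t_def)
    have s2: "s\<^sup>2 = a * b" using pos by (simp add: a_b_s_t_def(3))
    have "inverse s \<le> C * inverse t" "inverse t \<le> C * inverse s" "C\<^sup>2 * a < b"
      using elim x_pos[of i] q_pos[of "m i"] by (simp_all add: x_def a_b_s_t_def q_def)
    then have bounds: "t \<le> C * s" "s \<le> C * t" "C\<^sup>2 * a < b" using pos by (simp_all add: field_simps)
    show False
    \<comment> \<open>No denominator lies strictly between consecutive ones: either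
      \<open>t \<le> a\<close> or \<open>b \<le> t\<close>, and each forces
      \<open>b \<le> C\<^sup>2 * a\<close>.\<close>
    proof (cases "m i \<le> k i")
      case True
      then have "C * t \<le> C * a" using q_mono C(1) by (simp add: a_b_s_t_def)
      then have "s\<^sup>2 \<le> (C * a)\<^sup>2" using bounds pos by (intro power_mono) auto
      then have "a * b \<le> a * (C\<^sup>2 * a)" unfolding s2 by (simp add: power2_eq_square algebra_simps)
      then show False using pos bounds by simp
    next
      case False
      then have "b \<le> t" using q_mono by (simp add: a_b_s_t_def)
      then have "b\<^sup>2 \<le> (C * s)\<^sup>2" using bounds pos by (intro power_mono) auto
      then have "b * b \<le> b * (C\<^sup>2 * a)" unfolding power_mult_distrib s2
        by (simp add: power2_eq_square algebra_simps)
      then show False using pos bounds by simp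
    qed
  qed
  then show False using not_bot[OF ultra] by simp
qed

section \<open>Successors and the equality of growth and decay, condition (iv)\<close>

lemma growth_succ_eq:
  assumes "\<theta> \<in> badly_approximable"
  shows "growth U (best_denom_succ U \<theta> n) = growth U (best_denom_class U \<theta> n)"
proof -
  from assms obtain C where C: "\<And>k. real_of_int (best_denom \<theta> (Suc k)) \<le> C * of_int (best_denom \<theta> k)"
    unfolding badly_approximable_iff_ratio_bounded[OF irrational] by blast
  have "inverse (real_of_int (best_denom \<theta> (n i + 1))) \<le> 1 * inverse (of_int (best_denom \<theta> (n i)))"
    "inverse (real_of_int (best_denom \<theta> (n i))) \<le> C * inverse (of_int (best_denom \<theta> (n i + 1)))" for i
    using C[of "n i"] best_denom_pos[OF irrational, of "n i"] best_denom_pos[OF irrational, of "Suc (n i)"]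
      best_denom_pos_and_mono[OF irrational, of "n i"] by (simp_all add: field_simps)
  moreover have "0 < inverse (real_of_int (best_denom \<theta> k))" for k
    using best_denom_pos[OF irrational, of k] by simp
  ultimately show ?thesis
    unfolding best_denom_succ_def growth_best_denom_class
    by (intro seq_class_eqI[OF ultra inverse_best_denom_nonzero inverse_best_denom_nonzero, where C = 1 and D = C] always_eventually allI)
      (simp_all only: abs_of_pos)
qed

text \<open>The error at \<open>k\<close> lies between half the inverse of the next denominator and
  that inverse itself, whatever \<open>\<theta>\<close> is.\<close>

lemma decay_eq_growth_succ:
  assumes n: "filterlim n at_top U"
  shows "decay U \<theta> (best_denom_class U \<theta> n) = growth U (best_denom_succ U \<theta> n)"
proof -
  have "\<bar>approx_error \<theta> k\<bar> \<le> 1 * \<bar>inverse (real_of_int (best_denom \<theta> (k + 1)))\<bar>"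
    "\<bar>inverse (real_of_int (best_denom \<theta> (k + 1)))\<bar> \<le> 2 * \<bar>approx_error \<theta> k\<bar>" for k
    using approx_error_le_inverse[of k] approx_error_ge[OF irrational, of k]
      approx_error_pos[OF irrational, of k] best_denom_pos[OF irrational, of "Suc k"]
    by (simp_all add: field_simps)
  then show ?thesis
    unfolding best_denom_succ_def growth_best_denom_class decay_best_denom_class(2)[OF n]
    by (intro seq_class_eqI[OF ultra approx_error_nonzero inverse_best_denom_nonzero, where C = 1 and D = 2] always_eventually allI)
qed

lemma growth_eq_decay_if_pairs_eq:
  assumes "\<forall>(\<mu>, \<nu>)\<in>best_growth_decay_pairs U \<theta>. \<mu> = \<nu>" "best_index U n"
  shows "growth U (best_denom_class U \<theta> n) = decay U \<theta> (best_denom_class U \<theta> n)"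
proof -
  have "(growth U (best_denom_class U \<theta> n), decay U \<theta> (best_denom_class U \<theta> n))
      \<in> best_growth_decay_pairs U \<theta>"
    using assms(2) unfolding best_growth_decay_pairs_def by blast
  from bspec[OF assms(1) this] show ?thesis by simp
qed

text \<open>By \<open>decay_eq_growth_succ\<close>, equality in a pair says that a class and its
  successor have the same growth. Bounded ratios give this, and a class with infinitely larger
  successor violates it.\<close>

lemma badly_approximable_iff_pairs:
  "\<theta> \<in> badly_approximable \<longleftrightarrow> (\<forall>(\<mu>, \<nu>)\<in>best_growth_decay_pairs U \<theta>. \<mu> = \<nu>)" (is "_ = ?P")
proof
  assume "\<theta> \<in> badly_approximable"
  then show ?P
    by (auto simp: best_growth_decay_pairs_def best_index_def decay_eq_growth_succ growth_succ_eq)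
next
  assume P: ?P
  show "\<theta> \<in> badly_approximable"
  proof (rule ccontr)
    assume "\<theta> \<notin> badly_approximable"
    then obtain k where k: "best_index U k"
      "\<And>C. eventually (\<lambda>i. C * of_int (best_denom \<theta> (k i)) < real_of_int (best_denom \<theta> (Suc (k i)))) U"
      using not_badly_approximable_index by blast
    have "growth U (best_denom_class U \<theta> k) = decay U \<theta> (best_denom_class U \<theta> k)"
      by (rule growth_eq_decay_if_pairs_eq[OF P k(1)])
    also have "\<dots> = growth U (best_denom_succ U \<theta> k)"
      using k(1) by (intro decay_eq_growth_succ) (simp add: best_index_def)
    finally have eq: "seq_class U (\<lambda>i. inverse (of_int (best_denom \<theta> (k i)))) =
        seq_class U (\<lambda>i. inverse (of_int (best_denom \<theta> (k i + 1))))"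
      unfolding best_denom_succ_def growth_best_denom_class .
    obtain C where C: "eventually (\<lambda>i.
        \<bar>inverse (real_of_int (best_denom \<theta> (k i)))\<bar> \<le> C * \<bar>inverse (real_of_int (best_denom \<theta> (k i + 1)))\<bar> \<and>
        \<bar>inverse (real_of_int (best_denom \<theta> (k i + 1)))\<bar> \<le> C * \<bar>inverse (real_of_int (best_denom \<theta> (k i)))\<bar>) U"
      using seq_class_eqD[OF ultra inverse_best_denom_nonzero inverse_best_denom_nonzero eq] by blast
    from C k(2)[of C] have "eventually (\<lambda>i. False) U"
    proof eventually_elim
      case (elim i)
      then show False
        using best_denom_pos[OF irrational, of "k i"] best_denom_pos[OF irrational, of "Suc (k i)"]
        by (simp add: field_simps del: best_denom.simps)
    qed
    then show False using not_bot[OF ultra] by simp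
  qed
qed

text \<open>Both sets are indexed by the same sequences and agree term by term.\<close>

lemma pairs_eq_imp_growths_eq_decays:
  assumes "\<forall>(\<mu>, \<nu>)\<in>best_growth_decay_pairs U \<theta>. \<mu> = \<nu>"
  shows "best_growths U \<theta> = best_decays U \<theta>"
  unfolding best_growths_def best_decays_def
  using growth_eq_decay_if_pairs_eq[OF assms] by (intro Collect_cong ex_cong1) auto

end

theorem theorem5:
  fixes U :: "nat filter" and \<theta> :: real
  assumes "nonprincipal_ultrafilter U" and "\<theta> \<notin> \<rat>"
  shows
    "(\<theta> \<in> badly_approximable \<longleftrightarrow>
        (\<forall>\<mu>\<in>PP_eps U. \<forall>\<nu>\<in>PP_eps U. PP_le U \<nu> \<mu> \<longrightarrow>
           growth_decay_group U \<theta> \<mu> \<nu> = {star_of U 0})) \<and>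
     (\<theta> \<in> badly_approximable \<longleftrightarrow> best_growths U \<theta> = PP_eps U) \<and>
     (best_growths U \<theta> = PP_eps U \<longrightarrow>
        (\<forall>n. best_index U n \<longrightarrow>
           growth U (best_denom_succ U \<theta> n) = growth U (best_denom_class U \<theta> n))) \<and>
     (\<theta> \<in> badly_approximable \<longleftrightarrow>
        (\<forall>(\<mu>, \<nu>)\<in>best_growth_decay_pairs U \<theta>. \<mu> = \<nu>)) \<and>
     ((\<forall>(\<mu>, \<nu>)\<in>best_growth_decay_pairs U \<theta>. \<mu> = \<nu>) \<longrightarrow>
        best_growths U \<theta> = best_decays U \<theta>)"
proof (intro conjI impI allI)
  show "\<theta> \<in> badly_approximable \<longleftrightarrow>
      (\<forall>\<mu>\<in>PP_eps U. \<forall>\<nu>\<in>PP_eps U. PP_le U \<nu> \<mu> \<longrightarrow>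
         growth_decay_group U \<theta> \<mu> \<nu> = {star_of U 0})" (is "_ = ?ii")
  proof
    assume ii: ?ii
    show "\<theta> \<in> badly_approximable"
    proof (rule ccontr)
      assume "\<theta> \<notin> badly_approximable"
      then obtain \<mu> where "\<mu> \<in> PP_eps U" "growth_decay_group U \<theta> \<mu> \<mu> \<noteq> {star_of U 0}"
        by (rule growth_decay_group_nontrivial[OF assms])
      \<comment> \<open>Condition (ii) is applied with equal parameters, where the order hypothesis
        holds by reflexivity.\<close>
      with ii show False by (auto simp: PP_le_def)
    qed
  qed (simp add: growth_decay_group_trivial[OF assms])
  show iii: "\<theta> \<in> badly_approximable \<longleftrightarrow> best_growths U \<theta> = PP_eps U"
    using badly_approximable_best_growths[OF assms] best_growths_badly_approximable[OF assms] by blast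
  show "growth U (best_denom_succ U \<theta> n) = growth U (best_denom_class U \<theta> n)"
    if "best_growths U \<theta> = PP_eps U" for n
    using growth_succ_eq[OF assms] iii that by blast
  show "\<theta> \<in> badly_approximable \<longleftrightarrow> (\<forall>(\<mu>, \<nu>)\<in>best_growth_decay_pairs U \<theta>. \<mu> = \<nu>)"
    by (rule badly_approximable_iff_pairs[OF assms])
  show "best_growths U \<theta> = best_decays U \<theta>"
    if "\<forall>(\<mu>, \<nu>)\<in>best_growth_decay_pairs U \<theta>. \<mu> = \<nu>"
    by (rule pairs_eq_imp_growths_eq_decays[OF assms that])
qed

end
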